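(* Let $G$ be a finite group of order $n$ and let $d\ge2$. There is a unitary matrix $U\in\mathrm U(n,\mathbb C)$, with rows indexed by triples $(\rho,i,j)$, $\rho\in\widehat G$, $i,j\in[n_\rho]$, and columns indexed by $G$, and there are constants $\gamma_\rho\in\mathbb C^\times$, $\rho\in\widehat G$, such that $$(U,\dots,U)\cdot C^G(x)=\bigoplus_{\rho\in\widehat G}\gamma_\rho\,\mathsf M^{(d)}_{\rho(x)},$$ where $\rho(x)=\sum_{g\in G}x_g\rho(g)\in\mathrm{End}(\mathbb C^{n_\rho})$ and the $\rho$-th summand occupies the indices $(\rho,i,j)$ in every mode.
   Context: $\widehat G$ is a complete set of pairwise inequivalent irreducible unitary complex representations of $G$, $n_\rho=\dim\rho$ (so $\sum_\rho n_\rho^2=n$). The group tensor $C^G(x)$ is the hypermatrix with $d$ modes indexed by $G$ and entries $C^G(x)_{g_1,\dots,g_d}=x_{g_1\cdots g_d}$ ($x_g$ commuting variables, or complex numbers). A matrix $U$ acts on every mode: $((U,\dots,U)\cdot T)_{r_1,\dots,r_d}=\sum_{g_1,\dots,g_d}U_{r_1g_1}\cdots U_{r_dg_d}T_{g_1,\dots,g_d}$. For an $m\times m$ matrix $X$, $\mathsf M^{(d)}_X$ is the hypermatrix with $d$ modes indexed by pairs $(i,j)\in[m]^2$ and entries $(\mathsf M^{(d)}_X)_{(i_1,j_1),\dots,(i_d,j_d)}=\delta_{j_1=i_2}\delta_{j_2=i_3}\cdots\delta_{j_{d-1}=i_d}X_{i_1j_d}$. The direct sum of hypermatrices places them block-diagonally: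 the result is $\gamma_\rho\mathsf M^{(d)}_{\rho(x)}$ on indices all belonging to the $\rho$-block and $0$ whenever the indices in different modes belong to different blocks. *)

theory Defs
  imports
    "HOL-Algebra.Group"
    "HOL-Algebra.Coset"
    "Jordan_Normal_Form.VS_Connect"
    "Jordan_Normal_Form.Schur_Decomposition"
begin

section \<open>Unitary matrix representations\<close>

definition unitary_mat :: "nat \<Rightarrow> complex mat \<Rightarrow> bool" where
  "unitary_mat n A \<longleftrightarrow>
     A \<in> carrier_mat n n \<and> mat_adjoint A * A = 1\<^sub>m n \<and> A * mat_adjoint A = 1\<^sub>m n"

definition rep_dim :: "('a, 'b) monoid_scheme \<Rightarrow> ('a \<Rightarrow> complex mat) \<Rightarrow> nat" where
  "rep_dim G \<rho> = dim_row (\<rho> \<one>\<^bsub>G\<^esub>)"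

definition unitary_rep :: "('a, 'b) monoid_scheme \<Rightarrow> ('a \<Rightarrow> complex mat) \<Rightarrow> bool" where
  "unitary_rep G \<rho> \<longleftrightarrow>
     (\<forall>g\<in>carrier G. unitary_mat (rep_dim G \<rho>) (\<rho> g)) \<and>
     (\<forall>g\<in>carrier G. \<forall>h\<in>carrier G. \<rho> (g \<otimes>\<^bsub>G\<^esub> h) = \<rho> g * \<rho> h)"

definition irreducible_rep :: "('a, 'b) monoid_scheme \<Rightarrow> ('a \<Rightarrow> complex mat) \<Rightarrow> bool" where
  "irreducible_rep G \<rho> \<longleftrightarrow>
     rep_dim G \<rho> > 0 \<and>
     (\<forall>W. VectorSpace.subspace class_ring W (module_vec TYPE(complex) (rep_dim G \<rho>)) \<longrightarrow>
          (\<forall>g\<in>carrier G. \<forall>w\<in>W. \<rho> g *\<^sub>v w \<in> W) \<longrightarrow>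
          W = {0\<^sub>v (rep_dim G \<rho>)} \<or> W = carrier_vec (rep_dim G \<rho>))"

definition equivalent_reps ::
  "('a, 'b) monoid_scheme \<Rightarrow> ('a \<Rightarrow> complex mat) \<Rightarrow> ('a \<Rightarrow> complex mat) \<Rightarrow> bool" where
  "equivalent_reps G \<rho> \<sigma> \<longleftrightarrow>
     rep_dim G \<rho> = rep_dim G \<sigma> \<and>
     (\<exists>P \<in> carrier_mat (rep_dim G \<rho>) (rep_dim G \<rho>).
        invertible_mat P \<and> (\<forall>g\<in>carrier G. P * \<rho> g = \<sigma> g * P))"

text \<open>Representations are total functions, only their values on the carrier matter. Two
  functions that agree on the carrier are equivalent, so pairwise inequivalence also
  excludes such duplicates.\<close>

definition unitary_dual :: "('a, 'b) monoid_scheme \<Rightarrow> ('a \<Rightarrow> complex mat) set \<Rightarrow> bool" where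
  "unitary_dual G R \<longleftrightarrow>
     (\<forall>\<rho>\<in>R. unitary_rep G \<rho> \<and> irreducible_rep G \<rho>) \<and>
     (\<forall>\<rho>\<in>R. \<forall>\<sigma>\<in>R. \<rho> \<noteq> \<sigma> \<longrightarrow> \<not> equivalent_reps G \<rho> \<sigma>) \<and>
     (\<forall>\<sigma>. unitary_rep G \<sigma> \<and> irreducible_rep G \<sigma> \<longrightarrow> (\<exists>\<rho>\<in>R. equivalent_reps G \<sigma> \<rho>))"

text \<open>The matrix $\rho(x) = \sum_g x_g \rho(g)$, formed entrywise.\<close>

definition rep_lin :: "('a, 'b) monoid_scheme \<Rightarrow> ('a \<Rightarrow> complex mat) \<Rightarrow> ('a \<Rightarrow> complex) \<Rightarrow> complex mat" where
  "rep_lin G \<rho> x =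
     mat (rep_dim G \<rho>) (rep_dim G \<rho>) (\<lambda>ij. \<Sum>g\<in>carrier G. x g * \<rho> g $$ ij)"

section \<open>Hypermatrices\<close>

text \<open>A hypermatrix with \<open>d\<close> modes indexed by a set \<open>I\<close> is a function on lists, of which only
  the values on \<open>index_tuples d I\<close> are relevant.\<close>

type_synonym 'i hypermatrix = "'i list \<Rightarrow> complex"

definition index_tuples :: "nat \<Rightarrow> 'i set \<Rightarrow> 'i list set" where
  "index_tuples d I = {is. set is \<subseteq> I \<and> length is = d}"

definition group_tensor :: "('a, 'b) monoid_scheme \<Rightarrow> ('a \<Rightarrow> complex) \<Rightarrow> 'a hypermatrix" where
  "group_tensor G x gs = x (foldr (\<lambda>g h. g \<otimes>\<^bsub>G\<^esub> h) gs \<one>\<^bsub>G\<^esub>)"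

definition mode_action ::
  "nat \<Rightarrow> 'c set \<Rightarrow> ('r \<Rightarrow> 'c \<Rightarrow> complex) \<Rightarrow> 'c hypermatrix \<Rightarrow> 'r hypermatrix" where
  "mode_action d J U T rs =
     (\<Sum>gs\<in>index_tuples d J. (\<Prod>k<d. U (rs ! k) (gs ! k)) * T gs)"

text \<open>Matrix indices are zero-based, so $[m]$ is \<open>{..<m}\<close>.\<close>

definition matmul_tensor :: "nat \<Rightarrow> complex mat \<Rightarrow> (nat \<times> nat) hypermatrix" where
  "matmul_tensor d X ps =
     (\<Prod>k<d - 1. of_bool (snd (ps ! k) = fst (ps ! Suc k))) * X $$ (fst (ps ! 0), snd (ps ! (d - 1)))"

definition hyper_direct_sum :: "('s \<Rightarrow> 'i hypermatrix) \<Rightarrow> ('s \<times> 'i) hypermatrix" where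
  "hyper_direct_sum T rs =
     (if \<forall>r\<in>set rs. fst r = fst (hd rs) then T (fst (hd rs)) (map snd rs) else 0)"

definition unitary_on :: "nat \<Rightarrow> 'r set \<Rightarrow> 'c set \<Rightarrow> ('r \<Rightarrow> 'c \<Rightarrow> complex) \<Rightarrow> bool" where
  "unitary_on n I J U \<longleftrightarrow>
     finite I \<and> card I = n \<and> finite J \<and> card J = n \<and>
     (\<forall>r\<in>I. \<forall>s\<in>I. (\<Sum>g\<in>J. U r g * cnj (U s g)) = of_bool (r = s)) \<and>
     (\<forall>g\<in>J. \<forall>h\<in>J. (\<Sum>r\<in>I. cnj (U r g) * U r h) = of_bool (g = h))"

definition block_index ::
  "('a, 'b) monoid_scheme \<Rightarrow> ('a \<Rightarrow> complex mat) set \<Rightarrow> (('a \<Rightarrow> complex mat) \<times> nat \<times> nat) set" where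
  "block_index G R = (SIGMA \<rho>:R. {..<rep_dim G \<rho>} \<times> {..<rep_dim G \<rho>})"

end

theory Submission
  imports Defs "Jordan_Normal_Form.Spectral_Radius"
begin

text \<open>The rows of \<open>U\<close> are the normalised matrix coefficients
  \<open>U (\<rho>, i, j) g = sqrt (n\<^sub>\<rho> / n) * \<rho>(g)\<^sub>i\<^sub>j\<close>. They are orthonormal by Schur orthogonality.
  They are complete because a function \<open>f\<close> with \<open>\<rho>(f) = 0\<close> for all irreducible \<open>\<rho>\<close> satisfies
  \<open>\<sigma>(f) = 0\<close> for every unitary representation \<open>\<sigma>\<close>, by splitting off invariant subspaces, and the
  regular representation recovers the values of \<open>f\<close>.
  The entry of \<open>(U, \<dots>, U) \<cdot> C\<^sup>G(x)\<close> at \<open>r\<^sub>1, \<dots>, r\<^sub>d\<close> pairs \<open>x\<close> with the convolution of the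
  corresponding coefficients, and Schur orthogonality collapses each convolution of two
  coefficients to \<open>\<delta> * (n / n\<^sub>\<rho>)\<close> times a single one. Hence
  \<open>\<gamma>\<^sub>\<rho> = c * (1 / c) ^ (d - 1)\<close> with \<open>c = sqrt (n\<^sub>\<rho> / n)\<close>.\<close>

section \<open>Orthonormal families\<close>

text \<open>Only the row relations of \<open>unitary_on\<close>, without finiteness or cardinality:
  for finite \<open>J\<close> the finiteness of the row set is a consequence, drawn in
  \<open>orthonormal_on_finite\<close>.\<close>

definition orthonormal_on :: "'r set \<Rightarrow> 'c set \<Rightarrow> ('r \<Rightarrow> 'c \<Rightarrow> complex) \<Rightarrow> bool" where
  "orthonormal_on I J U \<longleftrightarrow>
     (\<forall>r\<in>I. \<forall>s\<in>I. (\<Sum>g\<in>J. U r g * cnj (U s g)) = of_bool (r = s))"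

text \<open>The Gram-Schmidt step: in the inner product with \<open>U s\<close>, orthonormality
  leaves only the summand \<open>r = s\<close> of the projection, which cancels the coefficient of
  \<open>v\<close>. It serves Bessel's inequality, the extension of orthonormal families and the
  completeness of the matrix coefficients.\<close>

lemma orthonormal_on_residue:
  assumes "orthonormal_on F J U" "finite F" "s \<in> F"
  shows "(\<Sum>g\<in>J. (v g - (\<Sum>r\<in>F. (\<Sum>h\<in>J. v h * cnj (U r h)) * U r g)) * cnj (U s g)) = 0"
proof -
  let ?c = "\<lambda>r. \<Sum>h\<in>J. v h * cnj (U r h)"
  have "(\<Sum>g\<in>J. (\<Sum>r\<in>F. ?c r * U r g) * cnj (U s g)) = (\<Sum>r\<in>F. ?c r * (\<Sum>g\<in>J. U r g * cnj (U s g)))"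
    by (subst sum_distrib_left, subst sum.swap, simp add: sum_distrib_right sum_distrib_left mult.assoc)
  also have "\<dots> = (\<Sum>r\<in>F. if r = s then ?c r else 0)"
    using assms unfolding orthonormal_on_def by (intro sum.cong) auto
  also have "\<dots> = ?c s" using assms by simp
  finally show ?thesis by (simp add: left_diff_distrib sum_subtractf)
qed

text \<open>Bessel's inequality for the point mass at \<open>h\<close>: the squared norm of its
  residue \<open>f\<close> is one minus the left-hand side, hence that difference is
  nonnegative.\<close>

lemma bessel_point:
  assumes U: "orthonormal_on F J U" and F: "finite F" and J: "finite J" and h: "h \<in> J"
  shows "(\<Sum>r\<in>F. (cmod (U r h))\<^sup>2) \<le> 1"
proof -
  define f where "f g = of_bool (g = h) - (\<Sum>r\<in>F. cnj (U r h) * U r g)" for g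
  have "(\<Sum>k\<in>J. of_bool (k = h) * cnj (U r k)) = (\<Sum>k\<in>J. if k = h then cnj (U r k) else 0)" for r
    by (intro sum.cong) auto
  hence coeff: "(\<Sum>k\<in>J. of_bool (k = h) * cnj (U r k)) = cnj (U r h)" for r
    using J h by simp
  have ortho: "(\<Sum>g\<in>J. f g * cnj (U s g)) = 0" if "s \<in> F" for s
    using orthonormal_on_residue[OF U F that, of "\<lambda>g. of_bool (g = h)"]
    unfolding coeff f_def .
  have cnj_f: "cnj (f g) = of_bool (g = h) - (\<Sum>r\<in>F. U r h * cnj (U r g))" for g
    unfolding f_def by simp
  \<comment> \<open>As \<open>f\<close> is orthogonal to every row, only the point mass in the
    second factor contributes, and the squared norm of \<open>f\<close> is
    \<open>f h\<close>.\<close>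
  have "(\<Sum>g\<in>J. f g * cnj (f g))
      = (\<Sum>g\<in>J. f g * of_bool (g = h)) - (\<Sum>s\<in>F. \<Sum>g\<in>J. f g * (U s h * cnj (U s g)))"
    by (subst sum.swap) (simp add: cnj_f right_diff_distrib sum_subtractf sum_distrib_left)
  also have "(\<Sum>s\<in>F. \<Sum>g\<in>J. f g * (U s h * cnj (U s g))) = (\<Sum>s\<in>F. U s h * (\<Sum>g\<in>J. f g * cnj (U s g)))"
    by (simp add: sum_distrib_left mult.left_commute)
  also have "\<dots> = 0" using ortho by simp
  also have "(\<Sum>g\<in>J. f g * of_bool (g = h)) - 0 = (\<Sum>g\<in>J. f g * of_bool (g = h))" by simp
  also have "\<dots> = (\<Sum>g\<in>J. if g = h then f g else 0)" by (intro sum.cong) auto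
  also have "\<dots> = f h" using J h by simp
  also have "\<dots> = 1 - (\<Sum>r\<in>F. complex_of_real ((cmod (U r h))\<^sup>2))"
    unfolding f_def by (simp add: complex_norm_square mult.commute del: of_real_power)
  finally have "(\<Sum>g\<in>J. complex_of_real ((cmod (f g))\<^sup>2)) = 1 - (\<Sum>r\<in>F. complex_of_real ((cmod (U r h))\<^sup>2))"
    by (simp only: complex_norm_square)
  hence "complex_of_real (\<Sum>g\<in>J. (cmod (f g))\<^sup>2) = complex_of_real (1 - (\<Sum>r\<in>F. (cmod (U r h))\<^sup>2))"
    by simp
  hence "(\<Sum>g\<in>J. (cmod (f g))\<^sup>2) = 1 - (\<Sum>r\<in>F. (cmod (U r h))\<^sup>2)"
    unfolding of_real_eq_iff .
  moreover have "(\<Sum>g\<in>J. (cmod (f g))\<^sup>2) \<ge> 0" by (intro sum_nonneg) auto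
  ultimately show ?thesis by linarith
qed

text \<open>Double counting of the squared moduli: each row has total 1, and each column has total
  at most 1 by \<open>bessel_point\<close>.\<close>

lemma orthonormal_on_card_le:
  assumes U: "orthonormal_on F J U" and F: "finite F" and J: "finite J"
  shows "card F \<le> card J"
proof -
  have "(\<Sum>g\<in>J. (cmod (U r g))\<^sup>2) = 1" if "r \<in> F" for r
  proof -
    have "complex_of_real (\<Sum>g\<in>J. (cmod (U r g))\<^sup>2) = (\<Sum>g\<in>J. U r g * cnj (U r g))"
      by (simp only: of_real_sum complex_norm_square)
    also have "\<dots> = of_real 1" using U that by (simp add: orthonormal_on_def)
    finally show ?thesis unfolding of_real_eq_iff .
  qed
  hence "real (card F) = (\<Sum>r\<in>F. \<Sum>g\<in>J. (cmod (U r g))\<^sup>2)" by simp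
  also have "\<dots> = (\<Sum>g\<in>J. \<Sum>r\<in>F. (cmod (U r g))\<^sup>2)" by (rule sum.swap)
  also have "\<dots> \<le> (\<Sum>g\<in>J. 1)" by (intro sum_mono bessel_point[OF U F J])
  finally show ?thesis by simp
qed

text \<open>\<open>unitary_dual\<close> does not state that the set of representations is finite.
  Finiteness of the row index set comes from the uniform bound on the size of its finite
  subsets.\<close>

lemma orthonormal_on_finite:
  assumes U: "orthonormal_on I J U" and J: "finite J"
  shows "finite I"
proof -
  have "card F \<le> card J" if "F \<subseteq> I" "finite F" for F
  proof (rule orthonormal_on_card_le)
    show "orthonormal_on F J U" using U that(1) unfolding orthonormal_on_def by blast
  qed (use that J in auto)
  thus ?thesis using finite_if_finite_subsets_card_bdd by blast
qed

section \<open>Matrices\<close>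

lemma adjoint_carrier [simp]:
  assumes "A \<in> carrier_mat n m" shows "mat_adjoint A \<in> carrier_mat m n"
  using assms unfolding mat_adjoint_def by auto

lemma adjoint_dim [simp]: "dim_row (mat_adjoint A) = dim_col A" "dim_col (mat_adjoint A) = dim_row A"
  unfolding mat_adjoint_def by auto

lemma adjoint_index:
  assumes "A \<in> carrier_mat n m" "i < m" "j < n"
  shows "mat_adjoint A $$ (i, j) = cnj (A $$ (j, i))"
  using assms unfolding mat_adjoint_def by (auto simp: mat_of_rows_def)

lemma mult_index:
  assumes "A \<in> carrier_mat n m" "B \<in> carrier_mat m k" "i < n" "j < k"
  shows "(A * B) $$ (i, j) = (\<Sum>l<m. A $$ (i, l) * B $$ (l, j))"
  using assms by (auto simp: scalar_prod_def lessThan_atLeast0)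

lemma mult_vec_index:
  assumes "A \<in> carrier_mat n m" "v \<in> carrier_vec m" "i < n"
  shows "(A *\<^sub>v v) $ i = (\<Sum>l<m. A $$ (i, l) * v $ l)"
  using assms by (auto simp: scalar_prod_def lessThan_atLeast0)

lemma adjoint_mult:
  fixes A B :: "complex mat"
  assumes A: "A \<in> carrier_mat n m" and B: "B \<in> carrier_mat m k"
  shows "mat_adjoint (A * B) = mat_adjoint B * mat_adjoint A"
proof (rule eq_matI)
  fix i j assume "i < dim_row (mat_adjoint B * mat_adjoint A)" "j < dim_col (mat_adjoint B * mat_adjoint A)"
  hence ij: "i < k" "j < n" using adjoint_carrier[OF A] adjoint_carrier[OF B] by auto
  have "mat_adjoint (A * B) $$ (i, j) = cnj ((A * B) $$ (j, i))"
    using A B ij by (intro adjoint_index[of _ n k]) auto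
  also have "\<dots> = (\<Sum>l<m. mat_adjoint B $$ (i, l) * mat_adjoint A $$ (l, j))"
    using ij by (simp add: mult_index[OF A B] adjoint_index[OF A] adjoint_index[OF B] mult.commute)
  also have "\<dots> = (mat_adjoint B * mat_adjoint A) $$ (i, j)"
    using ij A B by (subst mult_index[of _ k m _ n]) auto
  finally show "mat_adjoint (A * B) $$ (i, j) = (mat_adjoint B * mat_adjoint A) $$ (i, j)" .
qed auto

lemma adjoint_adjoint [simp]:
  fixes A :: "complex mat"
  assumes A: "A \<in> carrier_mat n m"
  shows "mat_adjoint (mat_adjoint A) = A"
proof (rule eq_matI)
  fix i j assume "i < dim_row A" "j < dim_col A"
  thus "mat_adjoint (mat_adjoint A) $$ (i, j) = A $$ (i, j)"
    using A by (simp add: adjoint_index[of _ m n] adjoint_index[OF A])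
qed auto

lemma mat_eqI_mult_vec:
  fixes A B :: "complex mat"
  assumes A: "A \<in> carrier_mat n m" and B: "B \<in> carrier_mat n m"
    and eq: "\<And>v. v \<in> carrier_vec m \<Longrightarrow> A *\<^sub>v v = B *\<^sub>v v"
  shows "A = B"
proof (rule eq_matI)
  fix i j assume "i < dim_row B" "j < dim_col B"
  hence ij: "i < n" "j < m" using B by auto
  have "C $$ (i, j) = (C *\<^sub>v unit_vec m j) $ i" if C: "C \<in> carrier_mat n m" for C :: "complex mat"
    using C ij by simp
  thus "A $$ (i, j) = B $$ (i, j)" using A B eq[of "unit_vec m j"] by simp
qed (use A B in auto)

text \<open>Cyclicity of the trace, used to compare dimensions, and the trace as squared Frobenius
  norm, used to see that it is positive for a nonzero matrix.\<close>

lemma sum_diag_mult_adjoint: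
  assumes A: "A \<in> carrier_mat n m"
  shows "(\<Sum>i<n. (A * mat_adjoint A) $$ (i, i)) = (\<Sum>j<m. (mat_adjoint A * A) $$ (j, j))"
    and "(\<Sum>i<n. (A * mat_adjoint A) $$ (i, i)) = of_real (\<Sum>i<n. \<Sum>j<m. (cmod (A $$ (i, j)))\<^sup>2)"
proof -
  have 1: "(\<Sum>i<n. (A * mat_adjoint A) $$ (i, i)) = (\<Sum>i<n. \<Sum>j<m. A $$ (i, j) * cnj (A $$ (i, j)))"
    using A by (intro sum.cong refl) (auto simp: mult_index[OF A adjoint_carrier[OF A]] adjoint_index[OF A] simp del: index_mult_mat)
  also have "\<dots> = (\<Sum>j<m. \<Sum>i<n. A $$ (i, j) * cnj (A $$ (i, j)))" by (rule sum.swap)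
  also have "\<dots> = (\<Sum>j<m. (mat_adjoint A * A) $$ (j, j))"
    using A by (intro sum.cong refl) (auto simp: mult_index[OF adjoint_carrier[OF A] A] adjoint_index[OF A] mult.commute simp del: index_mult_mat)
  finally show "(\<Sum>i<n. (A * mat_adjoint A) $$ (i, i)) = (\<Sum>j<m. (mat_adjoint A * A) $$ (j, j))" .
  show "(\<Sum>i<n. (A * mat_adjoint A) $$ (i, i)) = of_real (\<Sum>i<n. \<Sum>j<m. (cmod (A $$ (i, j)))\<^sup>2)"
    unfolding 1 by (simp only: of_real_sum complex_norm_square)
qed

section \<open>Subspaces and orthogonal projections\<close>

lemma subspace_vec_iff:
  "VectorSpace.subspace class_ring W (module_vec TYPE(complex) n) \<longleftrightarrow>
     W \<subseteq> carrier_vec n \<and> 0\<^sub>v n \<in> W \<and> (\<forall>v\<in>W. \<forall>w\<in>W. v + w \<in> W) \<and> (\<forall>c. \<forall>v\<in>W. c \<cdot>\<^sub>v v \<in> W)"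
  unfolding VectorSpace.subspace_def LinearCombinations.submodule_def
  using vec_vs[where 'a = complex and n = n] vec_module[where 'a = complex and n = n]
  by (auto simp: module_vec_simps class_ring_simps)

text \<open>The columns of \<open>Q\<close> are an orthonormal family in \<open>W\<close> of maximal length.\<close>

lemma subspace_orthonormal_basis:
  assumes W: "VectorSpace.subspace class_ring W (module_vec TYPE(complex) m)"
  obtains k Q where "Q \<in> carrier_mat m k" "mat_adjoint Q * Q = 1\<^sub>m k"
    "\<And>w. w \<in> W \<Longrightarrow> (Q * mat_adjoint Q) *\<^sub>v w = w"
    "\<And>v. v \<in> carrier_vec m \<Longrightarrow> (Q * mat_adjoint Q) *\<^sub>v v \<in> W"
proof -
  note W' = W[unfolded subspace_vec_iff]
  define P where "P k q \<longleftrightarrow> (\<forall>i<k. q i \<in> W) \<and> orthonormal_on {..<k} {..<m} (\<lambda>i a. q i $ a)"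
    for k and q :: "nat \<Rightarrow> complex vec"
  define S where "S = {k. \<exists>q. P k q}"
  \<comment> \<open>The length of an orthonormal family is bounded by the dimension and the empty
    family is one, so a maximal length exists.\<close>
  have "k \<le> m" if "k \<in> S" for k
    using that orthonormal_on_card_le[of "{..<k}" "{..<m}"] by (auto simp: S_def P_def)
  hence "finite S" by (meson finite_nat_set_iff_bounded_le)
  moreover have "0 \<in> S" unfolding S_def P_def by (auto simp: orthonormal_on_def)
  ultimately have max: "Max S \<in> S" "Suc (Max S) \<notin> S"
    using Max_in[of S] Max_ge[of S "Suc (Max S)"] by (blast, linarith)
  define k where "k = Max S"
  from max(1) obtain q where q: "P k q" unfolding S_def k_def by auto
  hence qW: "\<And>i. i < k \<Longrightarrow> q i \<in> W" and qo: "orthonormal_on {..<k} {..<m} (\<lambda>i a. q i $ a)"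
    unfolding P_def by auto
  have qc: "\<And>i. i < k \<Longrightarrow> q i \<in> carrier_vec m" using qW W' by auto
  define Q where "Q = mat m k (\<lambda>(a, i). q i $ a)"
  have Q: "Q \<in> carrier_mat m k" unfolding Q_def by simp
  have Q_index: "Q $$ (a, i) = q i $ a" if "a < m" "i < k" for a i
    unfolding Q_def using that by simp
  have QQ: "mat_adjoint Q * Q = 1\<^sub>m k"
  proof (rule eq_matI)
    fix i j assume "i < dim_row (1\<^sub>m k)" "j < dim_col (1\<^sub>m k)"
    hence ij: "i < k" "j < k" by auto
    have "(mat_adjoint Q * Q) $$ (i, j) = (\<Sum>a<m. q j $ a * cnj (q i $ a))"
      using ij by (subst mult_index[OF adjoint_carrier[OF Q] Q])
        (auto simp: adjoint_index[OF Q] Q_index mult.commute)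
    also have "\<dots> = of_bool (j = i)" using qo ij by (auto simp: orthonormal_on_def)
    finally show "(mat_adjoint Q * Q) $$ (i, j) = 1\<^sub>m k $$ (i, j)" using ij by auto
  qed (use Q adjoint_carrier[OF Q] in auto)
  \<comment> \<open>Closure of \<open>W\<close> under binary sums is extended to linear combinations
    one vector at a time; the bound \<open>l \<le> k\<close> keeps the vectors within the
    family.\<close>
  have comb: "vec m (\<lambda>a. \<Sum>i<l. c i * q i $ a) \<in> W" if "l \<le> k" for l c
    using that
  proof (induction l)
    case 0
    have "vec m (\<lambda>a. \<Sum>i<0. c i * q i $ a) = 0\<^sub>v m" by auto
    thus ?case using W' by simp
  next
    case (Suc l)
    have "vec m (\<lambda>a. \<Sum>i<Suc l. c i * q i $ a) = vec m (\<lambda>a. \<Sum>i<l. c i * q i $ a) + c l \<cdot>\<^sub>v q l"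
      using qc[of l] Suc.prems by (intro eq_vecI) auto
    moreover have "c l \<cdot>\<^sub>v q l \<in> W" using W' qW[of l] Suc.prems by auto
    ultimately show ?case using Suc W' by auto
  qed
  have proj: "(Q * mat_adjoint Q) *\<^sub>v v = vec m (\<lambda>a. \<Sum>i<k. (\<Sum>b<m. v $ b * cnj (q i $ b)) * q i $ a)"
    if v: "v \<in> carrier_vec m" for v
  proof (rule eq_vecI)
    fix a assume "a < dim_vec (vec m (\<lambda>a. \<Sum>i<k. (\<Sum>b<m. v $ b * cnj (q i $ b)) * q i $ a))"
    hence a: "a < m" by simp
    have "((Q * mat_adjoint Q) *\<^sub>v v) $ a = (Q *\<^sub>v (mat_adjoint Q *\<^sub>v v)) $ a"
      using assoc_mult_mat_vec[OF Q adjoint_carrier[OF Q] v] by simp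
    also have "\<dots> = (\<Sum>i<k. Q $$ (a, i) * (\<Sum>b<m. mat_adjoint Q $$ (i, b) * v $ b))"
      using v a Q mult_mat_vec_carrier[OF adjoint_carrier[OF Q] v]
      by (simp add: mult_vec_index[OF Q] mult_vec_index[OF adjoint_carrier[OF Q] v] del: index_mult_mat_vec)
    also have "\<dots> = (\<Sum>i<k. (\<Sum>b<m. v $ b * cnj (q i $ b)) * q i $ a)"
      using a by (intro sum.cong refl) (auto simp: adjoint_index[OF Q] Q_index mult.commute)
    finally show "((Q * mat_adjoint Q) *\<^sub>v v) $ a = vec m (\<lambda>a. \<Sum>i<k. (\<Sum>b<m. v $ b * cnj (q i $ b)) * q i $ a) $ a"
      using a by simp
  qed (use Q in auto)
  \<comment> \<open>If \<open>w\<close> were moved by the projection, its residue, normalised, would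
    extend the family and contradict maximality.\<close>
  have "(Q * mat_adjoint Q) *\<^sub>v w = w" if w: "w \<in> W" for w
  proof (rule ccontr)
    assume neq: "(Q * mat_adjoint Q) *\<^sub>v w \<noteq> w"
    have wc: "w \<in> carrier_vec m" using w W' by auto
    define p where "p = vec m (\<lambda>a. \<Sum>i<k. (\<Sum>b<m. w $ b * cnj (q i $ b)) * q i $ a)"
    have pc: "p \<in> carrier_vec m" and pW: "p \<in> W" and "p \<noteq> w"
      using neq comb[of k] proj[OF wc] unfolding p_def by auto
    \<comment> \<open>The difference is written with the factor -1 because
      \<open>subspace_vec_iff\<close> gives closure under sums and scalar multiples.\<close>
    define r where "r = w + (-1) \<cdot>\<^sub>v p"
    have rW: "r \<in> W" unfolding r_def using W' w pW by auto
    hence rc: "r \<in> carrier_vec m" using W' by auto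
    have r_ind: "r $ a = w $ a - p $ a" if "a < m" for a using that pc unfolding r_def by simp
    have ro: "(\<Sum>a<m. r $ a * cnj (q i $ a)) = 0" if "i < k" for i
    proof -
      have "(\<Sum>a<m. r $ a * cnj (q i $ a)) =
         (\<Sum>a<m. (w $ a - (\<Sum>j<k. (\<Sum>b<m. w $ b * cnj (q j $ b)) * q j $ a)) * cnj (q i $ a))"
        by (intro sum.cong refl) (auto simp: r_ind p_def)
      also have "\<dots> = 0" using orthonormal_on_residue[OF qo, of i "\<lambda>a. w $ a"] that by simp
      finally show ?thesis .
    qed
    have ro': "(\<Sum>a<m. q i $ a * cnj (r $ a)) = 0" if "i < k" for i
      using arg_cong[OF ro[OF that], of cnj] by (simp add: mult.commute)
    define N where "N = (\<Sum>a<m. (cmod (r $ a))\<^sup>2)"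
    have "\<exists>a<m. r $ a \<noteq> 0"
    proof (rule ccontr)
      assume "\<not> (\<exists>a<m. r $ a \<noteq> 0)"
      hence "p = w" using r_ind pc wc by (intro eq_vecI) auto
      thus False using \<open>p \<noteq> w\<close> by simp
    qed
    then obtain a where a: "a < m" "r $ a \<noteq> 0" by auto
    have "N > 0" unfolding N_def by (rule sum_pos2[of _ a]) (use a in auto)
    have rr: "(\<Sum>a<m. r $ a * cnj (r $ a)) = of_real N"
      unfolding N_def by (simp only: of_real_sum complex_norm_square)
    define s where "s = complex_of_real (1 / sqrt N)"
    have ss: "s * s * of_real N = 1" "cnj s = s"
      using \<open>N > 0\<close> unfolding s_def by (auto simp flip: of_real_mult)
    define q' where "q' i = (if i = k then s \<cdot>\<^sub>v r else q i)" for i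
    have "q' i \<in> W" if "i < Suc k" for i
      using that qW W' rW by (auto simp: q'_def less_Suc_eq)
    moreover have "orthonormal_on {..<Suc k} {..<m} (\<lambda>i a. q' i $ a)"
      unfolding orthonormal_on_def
    proof (intro ballI)
      fix i j assume "i \<in> {..<Suc k}" "j \<in> {..<Suc k}"
      hence ij: "i < k \<or> i = k" "j < k \<or> j = k" by auto
      have q'k: "q' k $ a = s * r $ a" if "a < m" for a using that rc by (auto simp: q'_def)
      have q'i: "q' i = q i" if "i < k" for i using that by (auto simp: q'_def)
      have "(\<Sum>a<m. q' k $ a * cnj (q' k $ a)) = s * s * (\<Sum>a<m. r $ a * cnj (r $ a))"
        unfolding sum_distrib_left using ss(2) by (intro sum.cong refl) (auto simp: q'k)
      hence kk: "(\<Sum>a<m. q' k $ a * cnj (q' k $ a)) = 1" using rr ss by simp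
      have "(\<Sum>a<m. q' k $ a * cnj (q i $ a)) = s * (\<Sum>a<m. r $ a * cnj (q i $ a))" for i
        unfolding sum_distrib_left by (intro sum.cong refl) (auto simp: q'k)
      hence ki: "(\<Sum>a<m. q' k $ a * cnj (q i $ a)) = 0" if "i < k" for i using ro that by simp
      have "(\<Sum>a<m. q i $ a * cnj (q' k $ a)) = s * (\<Sum>a<m. q i $ a * cnj (r $ a))" for i
        unfolding sum_distrib_left using ss(2) by (intro sum.cong refl) (auto simp: q'k)
      hence ik: "(\<Sum>a<m. q i $ a * cnj (q' k $ a)) = 0" if "i < k" for i using ro' that by simp
      show "(\<Sum>a<m. q' i $ a * cnj (q' j $ a)) = of_bool (i = j)"
        using ij qo kk ki ik q'i by (auto simp: orthonormal_on_def)
    qed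
    ultimately have "Suc k \<in> S" unfolding S_def P_def by blast
    thus False using max(2) unfolding k_def by simp
  qed
  moreover have "(Q * mat_adjoint Q) *\<^sub>v v \<in> W" if "v \<in> carrier_vec m" for v
    unfolding proj[OF that] by (rule comb) simp
  ultimately show ?thesis using that Q QQ by blast
qed

text \<open>The columns of \<open>Q\<close> are an orthonormal basis of the fixed space of
  \<open>P\<close>. Thus \<open>P\<close> and \<open>Q * mat_adjoint Q\<close> fix each other's
  range, and self-adjointness of both makes them equal. It will be applied to the complement of an
  invariant subspace.\<close>

lemma projection_factorization:
  fixes P :: "complex mat"
  assumes P: "P \<in> carrier_mat m m" and adj: "mat_adjoint P = P" and idem: "P * P = P"
  obtains k Q where "Q \<in> carrier_mat m k" "mat_adjoint Q * Q = 1\<^sub>m k" "Q * mat_adjoint Q = P"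
proof -
  define W where "W = {v \<in> carrier_vec m. P *\<^sub>v v = v}"
  have "VectorSpace.subspace class_ring W (module_vec TYPE(complex) m)"
    unfolding subspace_vec_iff W_def using P
    by (auto simp: mult_add_distrib_mat_vec[OF P] mult_mat_vec[OF P])
  then obtain k Q where Q: "Q \<in> carrier_mat m k" "mat_adjoint Q * Q = 1\<^sub>m k"
    "\<And>w. w \<in> W \<Longrightarrow> (Q * mat_adjoint Q) *\<^sub>v w = w"
    "\<And>v. v \<in> carrier_vec m \<Longrightarrow> (Q * mat_adjoint Q) *\<^sub>v v \<in> W"
    using subspace_orthonormal_basis by metis
  let ?R = "Q * mat_adjoint Q"
  have R: "?R \<in> carrier_mat m m" using Q(1) by auto
  have Radj: "mat_adjoint ?R = ?R"
    using adjoint_mult[OF Q(1) adjoint_carrier[OF Q(1)]] Q(1) by simp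
  have "?R * P = P"
  proof (rule mat_eqI_mult_vec)
    fix v :: "complex vec" assume v: "v \<in> carrier_vec m"
    have "P *\<^sub>v v \<in> W" unfolding W_def using P v idem assoc_mult_mat_vec[OF P P v] by auto
    thus "(?R * P) *\<^sub>v v = P *\<^sub>v v" using Q(3) assoc_mult_mat_vec[OF R P v] by simp
  qed (use P R in auto)
  \<comment> \<open>The adjoint of the preceding identity; both factors are self-adjoint, so only
    their order changes.\<close>
  hence "P * ?R = P" using adjoint_mult[OF R P] adj Radj by simp
  moreover have "P * ?R = ?R"
  proof (rule mat_eqI_mult_vec)
    fix v :: "complex vec" assume v: "v \<in> carrier_vec m"
    show "(P * ?R) *\<^sub>v v = ?R *\<^sub>v v" using Q(4)[OF v] assoc_mult_mat_vec[OF P R v] unfolding W_def by simp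
  qed (use P R in auto)
  ultimately show ?thesis using that Q by metis
qed

section \<open>Schur's lemma and Schur orthogonality\<close>

lemma rep_lin_carrier [simp]: "rep_lin G \<rho> f \<in> carrier_mat (rep_dim G \<rho>) (rep_dim G \<rho>)"
  unfolding rep_lin_def by simp

locale finite_group = group G for G (structure) +
  assumes finite_carrier [simp]: "finite (carrier G)"
begin

section \<open>Elementary properties of unitary representations\<close>

lemma rep_carrier:
  assumes "unitary_rep G \<rho>" "g \<in> carrier G"
  shows "\<rho> g \<in> carrier_mat (rep_dim G \<rho>) (rep_dim G \<rho>)"
  using assms unfolding unitary_rep_def unitary_mat_def by auto

lemma rep_mult:
  assumes "unitary_rep G \<rho>" "g \<in> carrier G" "h \<in> carrier G"
  shows "\<rho> (g \<otimes> h) = \<rho> g * \<rho> h"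
  using assms unfolding unitary_rep_def by auto

lemma rep_unitary:
  assumes "unitary_rep G \<rho>" "g \<in> carrier G"
  shows "mat_adjoint (\<rho> g) * \<rho> g = 1\<^sub>m (rep_dim G \<rho>)"
    and "\<rho> g * mat_adjoint (\<rho> g) = 1\<^sub>m (rep_dim G \<rho>)"
  using assms unfolding unitary_rep_def unitary_mat_def by auto

text \<open>The image of the identity is idempotent by multiplicativity and invertible by unitarity,
  hence the identity matrix.\<close>

lemma rep_one:
  assumes \<rho>: "unitary_rep G \<rho>"
  shows "\<rho> \<one> = 1\<^sub>m (rep_dim G \<rho>)"
proof -
  let ?m = "rep_dim G \<rho>"
  note c = rep_carrier[OF \<rho> one_closed]
  have "\<rho> \<one> = (mat_adjoint (\<rho> \<one>) * \<rho> \<one>) * \<rho> \<one>"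
    using rep_unitary[OF \<rho> one_closed] c by simp
  also have "\<dots> = mat_adjoint (\<rho> \<one>) * (\<rho> \<one> * \<rho> \<one>)"
    by (rule assoc_mult_mat[OF adjoint_carrier[OF c] c c])
  also have "\<rho> \<one> * \<rho> \<one> = \<rho> \<one>" using rep_mult[OF \<rho> one_closed one_closed] by simp
  finally show ?thesis using rep_unitary[OF \<rho> one_closed] by simp
qed

lemma rep_inv:
  assumes \<rho>: "unitary_rep G \<rho>" and g: "g \<in> carrier G"
  shows "\<rho> (inv g) = mat_adjoint (\<rho> g)"
proof -
  note c = rep_carrier[OF \<rho> g] and c' = rep_carrier[OF \<rho> inv_closed[OF g]]
  have "\<rho> (inv g) = \<rho> (inv g) * (\<rho> g * mat_adjoint (\<rho> g))"
    using rep_unitary[OF \<rho> g] c' by simp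
  also have "\<dots> = (\<rho> (inv g) * \<rho> g) * mat_adjoint (\<rho> g)"
    by (rule assoc_mult_mat[OF c' c adjoint_carrier[OF c], symmetric])
  also have "\<rho> (inv g) * \<rho> g = 1\<^sub>m (rep_dim G \<rho>)"
    using rep_mult[OF \<rho> inv_closed[OF g] g] rep_one[OF \<rho>] g by simp
  finally show ?thesis using left_mult_one_mat[OF adjoint_carrier[OF c]] by simp
qed

lemma rep_mult_index:
  assumes \<rho>: "unitary_rep G \<rho>" and "g \<in> carrier G" "h \<in> carrier G"
    and "i < rep_dim G \<rho>" "j < rep_dim G \<rho>"
  shows "\<rho> (g \<otimes> h) $$ (i, j) = (\<Sum>l<rep_dim G \<rho>. \<rho> g $$ (i, l) * \<rho> h $$ (l, j))"
  using assms mult_index[OF rep_carrier[OF \<rho>] rep_carrier[OF \<rho>]] rep_mult[OF \<rho>] by simp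

lemma rep_inv_index:
  assumes \<rho>: "unitary_rep G \<rho>" and "g \<in> carrier G"
    and "i < rep_dim G \<rho>" "j < rep_dim G \<rho>"
  shows "\<rho> (inv g) $$ (i, j) = cnj (\<rho> g $$ (j, i))"
  using assms adjoint_index[OF rep_carrier[OF \<rho>]] rep_inv[OF \<rho>] by simp

lemma sum_mult_left:
  assumes "h \<in> carrier G"
  shows "(\<Sum>g\<in>carrier G. F (h \<otimes> g)) = (\<Sum>g\<in>carrier G. F g)"
  by (rule sum.reindex_bij_witness[of _ "\<lambda>g. inv h \<otimes> g" "\<lambda>g. h \<otimes> g"])
    (use assms in \<open>auto simp: m_assoc[symmetric]\<close>)

text \<open>Schur's lemma: an eigenspace of \<open>A\<close> is invariant because \<open>A\<close>
  commutes with the representation, and nonzero, hence the whole space. The eigenvalue exists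
  because the field is complex and the dimension positive.\<close>

lemma irreducible_commuting_scalar:
  assumes \<rho>: "unitary_rep G \<rho>" and irr: "irreducible_rep G \<rho>"
    and A: "A \<in> carrier_mat (rep_dim G \<rho>) (rep_dim G \<rho>)"
    and comm: "\<And>g. g \<in> carrier G \<Longrightarrow> \<rho> g * A = A * \<rho> g"
  obtains c where "A = c \<cdot>\<^sub>m 1\<^sub>m (rep_dim G \<rho>)"
proof -
  let ?m = "rep_dim G \<rho>"
  have "?m > 0" using irr unfolding irreducible_rep_def by auto
  from spectrum_non_empty[OF A this] obtain c v where "eigenvector A v c"
    unfolding spectrum_def eigenvalue_def by auto
  hence v: "v \<in> carrier_vec ?m" "v \<noteq> 0\<^sub>v ?m" "A *\<^sub>v v = c \<cdot>\<^sub>v v"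
    using A unfolding eigenvector_def by auto
  define W where "W = {w \<in> carrier_vec ?m. A *\<^sub>v w = c \<cdot>\<^sub>v w}"
  have "VectorSpace.subspace class_ring W (module_vec TYPE(complex) ?m)"
    unfolding subspace_vec_iff W_def using A
    by (auto simp: mult_add_distrib_mat_vec[OF A] mult_mat_vec[OF A] smult_add_distrib_vec[of _ ?m]
        smult_smult_assoc mult.commute)
  moreover have "\<rho> g *\<^sub>v w \<in> W" if g: "g \<in> carrier G" and w: "w \<in> W" for g w
  proof -
    note c = rep_carrier[OF \<rho> g]
    have wc: "w \<in> carrier_vec ?m" and ew: "A *\<^sub>v w = c \<cdot>\<^sub>v w" using w unfolding W_def by auto
    have "A *\<^sub>v (\<rho> g *\<^sub>v w) = (A * \<rho> g) *\<^sub>v w" by (rule assoc_mult_mat_vec[OF A c wc, symmetric])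
    also have "\<dots> = \<rho> g *\<^sub>v (A *\<^sub>v w)" unfolding comm[OF g, symmetric] by (rule assoc_mult_mat_vec[OF c A wc])
    also have "\<dots> = c \<cdot>\<^sub>v (\<rho> g *\<^sub>v w)" unfolding ew by (rule mult_mat_vec[OF c wc])
    finally show ?thesis unfolding W_def using c wc by auto
  qed
  ultimately have "W = {0\<^sub>v ?m} \<or> W = carrier_vec ?m"
    using irr unfolding irreducible_rep_def by blast
  moreover have "v \<in> W" using v unfolding W_def by auto
  ultimately have W: "W = carrier_vec ?m" using v by auto
  have "A = c \<cdot>\<^sub>m 1\<^sub>m ?m"
  proof (rule mat_eqI_mult_vec[OF A])
    fix w :: "complex vec" assume w: "w \<in> carrier_vec ?m"
    hence "A *\<^sub>v w = c \<cdot>\<^sub>v w" using W unfolding W_def by blast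
    also have "\<dots> = (c \<cdot>\<^sub>m 1\<^sub>m ?m) *\<^sub>v w" using w by (intro eq_vecI) auto
    finally show "A *\<^sub>v w = (c \<cdot>\<^sub>m 1\<^sub>m ?m) *\<^sub>v w" .
  qed auto
  thus ?thesis using that by blast
qed

text \<open>Both \<open>A\<^sup>* A\<close> and \<open>A A\<^sup>*\<close> commute with the respective representation, so they are scalar;
  comparing \<open>A (A\<^sup>* A) = (A A\<^sup>*) A\<close> and the traces gives the same scalar and the same dimension.\<close>

lemma intertwiner_equivalent:
  assumes \<rho>: "unitary_rep G \<rho>" "irreducible_rep G \<rho>" and \<sigma>: "unitary_rep G \<sigma>" "irreducible_rep G \<sigma>"
    and A: "A \<in> carrier_mat (rep_dim G \<rho>) (rep_dim G \<sigma>)"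
    and comm: "\<And>g. g \<in> carrier G \<Longrightarrow> \<rho> g * A = A * \<sigma> g"
    and nz: "A \<noteq> 0\<^sub>m (rep_dim G \<rho>) (rep_dim G \<sigma>)"
  shows "equivalent_reps G \<sigma> \<rho>"
proof -
  let ?m = "rep_dim G \<rho>" and ?k = "rep_dim G \<sigma>" and ?B = "mat_adjoint A"
  have B: "?B \<in> carrier_mat ?k ?m" using A by simp
  have AB: "A * ?B \<in> carrier_mat ?m ?m" and BA: "?B * A \<in> carrier_mat ?k ?k" using A B by auto
  \<comment> \<open>Taking adjoints of the relation at \<open>inv g\<close> makes the adjoint of
    \<open>A\<close> an intertwiner in the opposite direction.\<close>
  have comm': "?B * \<rho> g = \<sigma> g * ?B" if g: "g \<in> carrier G" for g
  proof -
    note ig = inv_closed[OF g]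
    have "mat_adjoint (\<rho> (inv g) * A) = mat_adjoint (A * \<sigma> (inv g))" using comm[OF ig] by simp
    thus ?thesis
      using adjoint_mult[OF rep_carrier[OF \<rho>(1) ig] A] adjoint_mult[OF A rep_carrier[OF \<sigma>(1) ig]]
        rep_inv[OF \<rho>(1) ig] rep_inv[OF \<sigma>(1) ig] g by simp
  qed
  have "\<rho> g * (A * ?B) = (A * ?B) * \<rho> g" if g: "g \<in> carrier G" for g
  proof -
    note r = rep_carrier[OF \<rho>(1) g] and s = rep_carrier[OF \<sigma>(1) g]
    have "\<rho> g * (A * ?B) = (A * \<sigma> g) * ?B" using assoc_mult_mat[OF r A B] comm[OF g] by simp
    also have "\<dots> = A * (?B * \<rho> g)" using assoc_mult_mat[OF A s B] comm'[OF g] by simp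
    also have "\<dots> = (A * ?B) * \<rho> g" using assoc_mult_mat[OF A B r] by simp
    finally show ?thesis .
  qed
  then obtain \<mu> where \<mu>: "A * ?B = \<mu> \<cdot>\<^sub>m 1\<^sub>m ?m" using irreducible_commuting_scalar[OF \<rho> AB] by blast
  have "\<sigma> g * (?B * A) = (?B * A) * \<sigma> g" if g: "g \<in> carrier G" for g
  proof -
    note r = rep_carrier[OF \<rho>(1) g] and s = rep_carrier[OF \<sigma>(1) g]
    have "\<sigma> g * (?B * A) = (?B * \<rho> g) * A" using assoc_mult_mat[OF s B A] comm'[OF g] by simp
    also have "\<dots> = ?B * (A * \<sigma> g)" using assoc_mult_mat[OF B r A] comm[OF g] by simp
    also have "\<dots> = (?B * A) * \<sigma> g" using assoc_mult_mat[OF B A s] by simp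
    finally show ?thesis .
  qed
  then obtain \<nu> where \<nu>: "?B * A = \<nu> \<cdot>\<^sub>m 1\<^sub>m ?k" using irreducible_commuting_scalar[OF \<sigma> BA] by blast
  obtain i j where ij: "i < ?m" "j < ?k" "A $$ (i, j) \<noteq> 0"
    using nz A by (metis carrier_matD(1) carrier_matD(2) eq_matI index_zero_mat(1) index_zero_mat(2) index_zero_mat(3))
  have "\<mu> \<cdot>\<^sub>m A = (A * ?B) * A" unfolding \<mu> using A by (simp add: mult_smult_assoc_mat[OF one_carrier_mat A])
  also have "\<dots> = A * (?B * A)" by (rule assoc_mult_mat[OF A B A])
  also have "\<dots> = \<nu> \<cdot>\<^sub>m A" unfolding \<nu> using A by (simp add: mult_smult_distrib[OF A one_carrier_mat])
  finally have "(\<mu> \<cdot>\<^sub>m A) $$ (i, j) = (\<nu> \<cdot>\<^sub>m A) $$ (i, j)" by simp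
  hence \<mu>\<nu>: "\<mu> = \<nu>" using ij A by simp
  have tr\<mu>: "(\<Sum>i<?m. (A * ?B) $$ (i, i)) = of_nat ?m * \<mu>" unfolding \<mu> by simp
  have tr\<nu>: "(\<Sum>i<?k. (?B * A) $$ (i, i)) = of_nat ?k * \<nu>" unfolding \<nu> by simp
  \<comment> \<open>The trace of \<open>A * ?B\<close> is the squared Frobenius norm of
    \<open>A\<close>, positive by the nonzero entry; hence the scalar does not vanish.\<close>
  define S where "S = (\<Sum>i<?m. \<Sum>j<?k. (cmod (A $$ (i, j)))\<^sup>2)"
  have "S > 0" unfolding S_def
  proof (rule sum_pos2[of _ i])
    show "(\<Sum>j<?k. (cmod (A $$ (i, j)))\<^sup>2) > 0" by (rule sum_pos2[of _ j]) (use ij in auto)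
  qed (use ij in \<open>auto intro: sum_nonneg\<close>)
  moreover have "of_nat ?m * \<mu> = of_real S"
    using trans[OF tr\<mu>[symmetric] sum_diag_mult_adjoint(2)[OF A]] unfolding S_def .
  ultimately have \<mu>0: "\<mu> \<noteq> 0" by auto
  have "of_nat ?m * \<mu> = of_nat ?k * \<mu>" 
    using trans[OF trans[OF tr\<mu>[symmetric] sum_diag_mult_adjoint(1)[OF A]] tr\<nu>] unfolding \<mu>\<nu> .
  hence mk: "?m = ?k" using \<mu>0 by simp
  \<comment> \<open>The inverse of \<open>A\<close> up to dimension: \<open>invertible_mat\<close>
    asks for a square matrix, which the equality \<open>mk\<close> supplies.\<close>
  define C where "C = (1 / \<mu>) \<cdot>\<^sub>m ?B"
  have "A * C = 1\<^sub>m ?m" unfolding C_def mult_smult_distrib[OF A B] \<mu> using \<mu>0 by (auto intro!: eq_matI)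
  moreover have "C * A = 1\<^sub>m ?k" unfolding C_def using mult_smult_assoc_mat[OF B A] \<nu> \<mu>\<nu> \<mu>0 by (auto intro!: eq_matI)
  ultimately have "invertible_mat A"
    unfolding invertible_mat_def inverts_mat_def using A B mk by (auto intro!: exI[of _ C] simp: C_def)
  thus ?thesis unfolding equivalent_reps_def using mk A comm by (auto intro!: bexI[of _ A])
qed

text \<open>The unnormalised group average of
  \<open>\<rho> g * E * mat_adjoint (\<sigma> g)\<close>, where \<open>E\<close> is the matrix unit
  at \<open>(j, l)\<close>; its entries are the inner products of matrix coefficients.\<close>

definition coeff_average :: "('a \<Rightarrow> complex mat) \<Rightarrow> ('a \<Rightarrow> complex mat) \<Rightarrow> nat \<Rightarrow> nat \<Rightarrow> complex mat" where
  "coeff_average \<rho> \<sigma> j l = mat (rep_dim G \<rho>) (rep_dim G \<sigma>)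
     (\<lambda>(i, k). \<Sum>g\<in>carrier G. \<rho> g $$ (i, j) * cnj (\<sigma> g $$ (k, l)))"

lemma coeff_average_carrier [simp]: "coeff_average \<rho> \<sigma> j l \<in> carrier_mat (rep_dim G \<rho>) (rep_dim G \<sigma>)"
  unfolding coeff_average_def by simp

text \<open>Multiplication by \<open>\<rho> h\<close> translates the summation variable of the
  average; undoing the translation moves \<open>h\<close> over to \<open>\<sigma>\<close>.\<close>

lemma coeff_average_intertwines:
  assumes \<rho>: "unitary_rep G \<rho>" and \<sigma>: "unitary_rep G \<sigma>"
    and h: "h \<in> carrier G" and j: "j < rep_dim G \<rho>" and l: "l < rep_dim G \<sigma>"
  shows "\<rho> h * coeff_average \<rho> \<sigma> j l = coeff_average \<rho> \<sigma> j l * \<sigma> h"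
proof (rule eq_matI)
  let ?m = "rep_dim G \<rho>" and ?k = "rep_dim G \<sigma>" and ?A = "coeff_average \<rho> \<sigma> j l"
  note r = rep_carrier[OF \<rho> h] and s = rep_carrier[OF \<sigma> h]
  fix i k assume "i < dim_row (?A * \<sigma> h)" "k < dim_col (?A * \<sigma> h)"
  hence ik: "i < ?m" "k < ?k" using s by (auto simp: coeff_average_def)
  have "(\<rho> h * ?A) $$ (i, k) = (\<Sum>a<?m. \<Sum>g\<in>carrier G. \<rho> h $$ (i, a) * (\<rho> g $$ (a, j) * cnj (\<sigma> g $$ (k, l))))"
    using ik by (subst mult_index[OF r coeff_average_carrier]) (auto simp: coeff_average_def sum_distrib_left)
  also have "\<dots> = (\<Sum>g\<in>carrier G. \<Sum>a<?m. \<rho> h $$ (i, a) * (\<rho> g $$ (a, j) * cnj (\<sigma> g $$ (k, l))))"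
    by (rule sum.swap)
  also have "\<dots> = (\<Sum>g\<in>carrier G. \<rho> (h \<otimes> g) $$ (i, j) * cnj (\<sigma> g $$ (k, l)))"
    using h ik j by (intro sum.cong refl) (simp add: rep_mult_index[OF \<rho>] sum_distrib_right mult.assoc)
  \<comment> \<open>Rewriting \<open>g\<close> as \<open>inv h \<otimes> (h \<otimes> g)\<close>
    makes the summand a function of \<open>h \<otimes> g\<close>, as \<open>sum_mult_left\<close>
    requires.\<close>
  also have "\<dots> = (\<Sum>g\<in>carrier G. \<rho> (h \<otimes> g) $$ (i, j) * cnj (\<sigma> (inv h \<otimes> (h \<otimes> g)) $$ (k, l)))"
    using h by (intro sum.cong refl) (simp add: m_assoc[symmetric])
  also have "\<dots> = (\<Sum>g\<in>carrier G. \<rho> g $$ (i, j) * cnj (\<sigma> (inv h \<otimes> g) $$ (k, l)))"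
    by (rule sum_mult_left[OF h])
  also have "\<dots> = (\<Sum>g\<in>carrier G. \<Sum>b<?k. \<rho> g $$ (i, j) * cnj (\<sigma> g $$ (b, l)) * \<sigma> h $$ (b, k))"
    using h ik l by (intro sum.cong refl)
      (simp add: rep_mult_index[OF \<sigma>] rep_inv_index[OF \<sigma>] sum_distrib_left mult_ac)
  also have "\<dots> = (\<Sum>b<?k. \<Sum>g\<in>carrier G. \<rho> g $$ (i, j) * cnj (\<sigma> g $$ (b, l)) * \<sigma> h $$ (b, k))"
    by (rule sum.swap)
  also have "\<dots> = (?A * \<sigma> h) $$ (i, k)"
    using ik by (subst mult_index[OF coeff_average_carrier s]) (auto simp: coeff_average_def sum_distrib_right)
  finally show "(\<rho> h * ?A) $$ (i, k) = (?A * \<sigma> h) $$ (i, k)" .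
qed (use rep_carrier[OF \<rho> h] rep_carrier[OF \<sigma> h] in \<open>auto simp: coeff_average_def\<close>)

text \<open>A nonzero average would be an intertwiner, and by \<open>intertwiner_equivalent\<close>
  the representations would be equivalent.\<close>

lemma schur_orthogonality_inequivalent:
  assumes \<rho>: "unitary_rep G \<rho>" "irreducible_rep G \<rho>" and \<sigma>: "unitary_rep G \<sigma>" "irreducible_rep G \<sigma>"
    and ne: "\<not> equivalent_reps G \<sigma> \<rho>"
    and ij: "i < rep_dim G \<rho>" "j < rep_dim G \<rho>" and kl: "k < rep_dim G \<sigma>" "l < rep_dim G \<sigma>"
  shows "(\<Sum>g\<in>carrier G. \<rho> g $$ (i, j) * cnj (\<sigma> g $$ (k, l))) = 0"
proof -
  have "coeff_average \<rho> \<sigma> j l = 0\<^sub>m (rep_dim G \<rho>) (rep_dim G \<sigma>)"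
    using intertwiner_equivalent[OF \<rho> \<sigma> coeff_average_carrier coeff_average_intertwines[OF \<rho>(1) \<sigma>(1)]]
      ne ij kl by blast
  hence "coeff_average \<rho> \<sigma> j l $$ (i, k) = 0" using ij kl by simp
  thus ?thesis using ij kl by (simp add: coeff_average_def)
qed

text \<open>The average is a scalar matrix by Schur's lemma, and its trace determines the
  scalar.\<close>

lemma schur_orthogonality_self:
  assumes \<rho>: "unitary_rep G \<rho>" "irreducible_rep G \<rho>"
    and ij: "i < rep_dim G \<rho>" "j < rep_dim G \<rho>" and kl: "k < rep_dim G \<rho>" "l < rep_dim G \<rho>"
  shows "(\<Sum>g\<in>carrier G. \<rho> g $$ (i, j) * cnj (\<rho> g $$ (k, l)))
    = of_nat (Coset.order G) / of_nat (rep_dim G \<rho>) * of_bool (i = k \<and> j = l)"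
proof -
  let ?m = "rep_dim G \<rho>" and ?A = "coeff_average \<rho> \<rho> j l"
  obtain c where c: "?A = c \<cdot>\<^sub>m 1\<^sub>m ?m"
    using irreducible_commuting_scalar[OF \<rho> coeff_average_carrier coeff_average_intertwines[OF \<rho>(1) \<rho>(1)]]
      ij kl by blast
  have m: "?m > 0" using ij by auto
  have "of_nat ?m * c = (\<Sum>i<?m. ?A $$ (i, i))" unfolding c by simp
  also have "\<dots> = (\<Sum>i<?m. \<Sum>g\<in>carrier G. \<rho> g $$ (i, j) * cnj (\<rho> g $$ (i, l)))"
    by (simp add: coeff_average_def)
  also have "\<dots> = (\<Sum>g\<in>carrier G. \<Sum>i<?m. \<rho> g $$ (i, j) * cnj (\<rho> g $$ (i, l)))"
    by (rule sum.swap)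
  \<comment> \<open>By unitarity the sum over \<open>i\<close> is a matrix product with the adjoint
    in front, so every group element contributes an entry of the identity matrix.\<close>
  also have "\<dots> = (\<Sum>g\<in>carrier G. \<rho> (inv g \<otimes> g) $$ (l, j))"
    using ij kl by (intro sum.cong refl, subst rep_mult_index[OF \<rho>(1)])
      (auto simp: rep_inv_index[OF \<rho>(1)] mult.commute)
  also have "\<dots> = of_nat (Coset.order G) * of_bool (j = l)"
    using ij kl by (auto simp: rep_one[OF \<rho>(1)] Coset.order_def)
  finally have "c = of_nat (Coset.order G) / of_nat ?m * of_bool (j = l)"
    using m by (simp add: field_simps)
  moreover have "(\<Sum>g\<in>carrier G. \<rho> g $$ (i, j) * cnj (\<rho> g $$ (k, l))) = ?A $$ (i, k)"
    using ij kl by (simp add: coeff_average_def)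
  moreover have "?A $$ (i, k) = c * of_bool (i = k)" unfolding c using ij kl by simp
  ultimately show ?thesis by (auto simp: of_bool_def)
qed

end

section \<open>Completeness of the matrix coefficients\<close>

context finite_group
begin

text \<open>With adjoints given by group inverses, both unitarity equations are instances of
  multiplicativity. The dimension is read off at the identity, as in \<open>rep_dim\<close>.\<close>

lemma unitary_repI:
  assumes carr: "\<And>g. g \<in> carrier G \<Longrightarrow> \<rho> g \<in> carrier_mat m m"
    and mult: "\<And>g h. g \<in> carrier G \<Longrightarrow> h \<in> carrier G \<Longrightarrow> \<rho> (g \<otimes> h) = \<rho> g * \<rho> h"
    and one: "\<rho> \<one> = 1\<^sub>m m"
    and adj: "\<And>g. g \<in> carrier G \<Longrightarrow> mat_adjoint (\<rho> g) = \<rho> (inv g)"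
  shows "unitary_rep G \<rho>" "rep_dim G \<rho> = m"
proof -
  show m: "rep_dim G \<rho> = m" unfolding rep_dim_def one by simp
  have "\<rho> (inv g) * \<rho> g = 1\<^sub>m m" "\<rho> g * \<rho> (inv g) = 1\<^sub>m m" if "g \<in> carrier G" for g
    using that mult[of "inv g" g] mult[of g "inv g"] one by auto
  thus "unitary_rep G \<rho>"
    unfolding unitary_rep_def unitary_mat_def m using carr mult adj by auto
qed

text \<open>The sum over the group passes through multiplication by fixed matrices. The outer
  factors may be rectangular, so that both conjugation and embedding of a subrepresentation are
  covered.\<close>

lemma rep_lin_sandwich:
  assumes \<rho>: "unitary_rep G \<rho>" and A: "A \<in> carrier_mat k (rep_dim G \<rho>)"
    and B: "B \<in> carrier_mat (rep_dim G \<rho>) l" and ij: "i < k" "j < l"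
  shows "(\<Sum>g\<in>carrier G. f g * (A * \<rho> g * B) $$ (i, j)) = (A * rep_lin G \<rho> f * B) $$ (i, j)"
proof -
  let ?m = "rep_dim G \<rho>"
  have expand: "(A * C * B) $$ (i, j) = (\<Sum>b<?m. \<Sum>a<?m. A $$ (i, a) * C $$ (a, b) * B $$ (b, j))"
    if C: "C \<in> carrier_mat ?m ?m" for C
    using ij mult_index[OF mult_carrier_mat[OF A C] B ij] mult_index[OF A C ij(1)]
    by (simp add: sum_distrib_right del: index_mult_mat)
  have "(\<Sum>g\<in>carrier G. f g * (A * \<rho> g * B) $$ (i, j))
      = (\<Sum>g\<in>carrier G. \<Sum>b<?m. \<Sum>a<?m. A $$ (i, a) * (f g * \<rho> g $$ (a, b)) * B $$ (b, j))"
    by (intro sum.cong refl) (simp add: expand[OF rep_carrier[OF \<rho>]] sum_distrib_left mult_ac del: index_mult_mat)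
  also have "\<dots> = (\<Sum>b<?m. \<Sum>g\<in>carrier G. \<Sum>a<?m. A $$ (i, a) * (f g * \<rho> g $$ (a, b)) * B $$ (b, j))"
    by (rule sum.swap)
  also have "\<dots> = (\<Sum>b<?m. \<Sum>a<?m. \<Sum>g\<in>carrier G. A $$ (i, a) * (f g * \<rho> g $$ (a, b)) * B $$ (b, j))"
    by (intro sum.cong refl sum.swap)
  also have "\<dots> = (\<Sum>b<?m. \<Sum>a<?m. A $$ (i, a) * rep_lin G \<rho> f $$ (a, b) * B $$ (b, j))"
    by (intro sum.cong refl) (simp add: rep_lin_def sum_distrib_left sum_distrib_right)
  also have "\<dots> = (A * rep_lin G \<rho> f * B) $$ (i, j)" by (rule expand[symmetric]) simp
  finally show ?thesis .
qed

lemma rep_lin_zero_sandwich: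
  assumes \<rho>: "unitary_rep G \<rho>" and A: "A \<in> carrier_mat k (rep_dim G \<rho>)"
    and B: "B \<in> carrier_mat (rep_dim G \<rho>) l" and ij: "i < k" "j < l"
    and zero: "rep_lin G \<rho> f = 0\<^sub>m (rep_dim G \<rho>) (rep_dim G \<rho>)"
  shows "(\<Sum>g\<in>carrier G. f g * (A * \<rho> g * B) $$ (i, j)) = 0"
  unfolding rep_lin_sandwich[OF \<rho> A B ij] zero using A B ij by simp

text \<open>Conjugating \<open>\<rho>\<close> by a fixed invertible matrix gives
  \<open>\<sigma>\<close>, and the same conjugation relates the two sums weighted by
  \<open>f\<close>.\<close>

lemma rep_lin_zero_equivalent:
  assumes \<sigma>: "unitary_rep G \<sigma>" and \<rho>: "unitary_rep G \<rho>" and eq: "equivalent_reps G \<sigma> \<rho>"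
    and zero: "rep_lin G \<rho> f = 0\<^sub>m (rep_dim G \<rho>) (rep_dim G \<rho>)"
  shows "rep_lin G \<sigma> f = 0\<^sub>m (rep_dim G \<sigma>) (rep_dim G \<sigma>)"
proof -
  let ?m = "rep_dim G \<sigma>"
  have m: "rep_dim G \<rho> = ?m" using eq unfolding equivalent_reps_def by simp
  from eq obtain P where P: "P \<in> carrier_mat ?m ?m" "invertible_mat P"
    and comm: "\<And>g. g \<in> carrier G \<Longrightarrow> P * \<sigma> g = \<rho> g * P"
    unfolding equivalent_reps_def by auto
  from P obtain B where "P * B = 1\<^sub>m ?m" and BP: "B * P = 1\<^sub>m (dim_row B)"
    unfolding invertible_mat_def inverts_mat_def by auto
  hence B: "B \<in> carrier_mat ?m ?m" using P(1)
    by (metis carrier_mat_triv carrier_matD(2) index_mult_mat(3) index_one_mat(3))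
  have conj: "\<sigma> g = B * \<rho> g * P" if g: "g \<in> carrier G" for g
  proof -
    note r = rep_carrier[OF \<rho> g, unfolded m] and s = rep_carrier[OF \<sigma> g]
    have "B * \<rho> g * P = B * (P * \<sigma> g)" using assoc_mult_mat[OF B r P(1)] comm[OF g] by simp
    also have "\<dots> = (B * P) * \<sigma> g" using assoc_mult_mat[OF B P(1) s] by simp
    finally show ?thesis using BP B s by simp
  qed
  show ?thesis
  proof (rule eq_matI)
    fix i j assume "i < dim_row (0\<^sub>m ?m ?m :: complex mat)" "j < dim_col (0\<^sub>m ?m ?m :: complex mat)"
    hence ij: "i < ?m" "j < ?m" by auto
    have "rep_lin G \<sigma> f $$ (i, j) = (\<Sum>g\<in>carrier G. f g * (B * \<rho> g * P) $$ (i, j))"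
      using ij unfolding rep_lin_def by (simp add: conj del: index_mult_mat)
    also have "\<dots> = 0" using rep_lin_zero_sandwich[OF \<rho> _ _ ij zero] B P(1) m by simp
    finally show "rep_lin G \<sigma> f $$ (i, j) = 0\<^sub>m ?m ?m $$ (i, j)" using ij by simp
  qed (auto simp: rep_lin_def)
qed

text \<open>The subrepresentation on the range of the isometry \<open>Q\<close>, in the coordinates
  given by its columns. The last claim carries it back to the ambient space.\<close>

lemma compressed_rep:
  assumes \<sigma>: "unitary_rep G \<sigma>" and Q: "Q \<in> carrier_mat (rep_dim G \<sigma>) k"
    and QQ: "mat_adjoint Q * Q = 1\<^sub>m k"
    and comm: "\<And>g. g \<in> carrier G \<Longrightarrow> (Q * mat_adjoint Q) * \<sigma> g = \<sigma> g * (Q * mat_adjoint Q)"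
  defines "\<tau> \<equiv> \<lambda>g. mat_adjoint Q * (\<sigma> g * Q)"
  shows "unitary_rep G \<tau>" "rep_dim G \<tau> = k"
    and "\<And>g. g \<in> carrier G \<Longrightarrow> Q * \<tau> g * mat_adjoint Q = \<sigma> g * (Q * mat_adjoint Q)"
proof -
  let ?m = "rep_dim G \<sigma>" and ?A = "mat_adjoint Q" and ?P = "Q * mat_adjoint Q"
  have A: "?A \<in> carrier_mat k ?m" using Q by simp
  have P: "?P \<in> carrier_mat ?m ?m" using A Q by auto
  have AP: "?A * ?P = ?A" using assoc_mult_mat[OF A Q A] QQ left_mult_one_mat[OF A] by simp
  have PP: "?P * ?P = ?P" using assoc_mult_mat[OF Q A P] AP by simp
  have s: "\<sigma> g \<in> carrier_mat ?m ?m" if "g \<in> carrier G" for g using rep_carrier[OF \<sigma> that] .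
  have sQ: "\<sigma> g * Q \<in> carrier_mat ?m k" if "g \<in> carrier G" for g using s[OF that] Q by auto
  have \<tau>_eq: "\<tau> g = ?A * (\<sigma> g * Q)" for g unfolding \<tau>_def ..
  have t: "\<tau> g \<in> carrier_mat k k" if "g \<in> carrier G" for g
    unfolding \<tau>_def using A sQ[OF that] by auto
  have "\<tau> (g \<otimes> h) = \<tau> g * \<tau> h" if g: "g \<in> carrier G" and h: "h \<in> carrier G" for g h
  proof -
    \<comment> \<open>The product produces the projection between \<open>\<sigma> g\<close> and
      \<open>\<sigma> h\<close>; it commutes to the left and is absorbed by the adjoint of
      \<open>Q\<close>.\<close>
    have "\<tau> g * \<tau> h = ?A * ((\<sigma> g * Q) * \<tau> h)"
      unfolding \<tau>_eq[of g] by (rule assoc_mult_mat[OF A sQ[OF g] t[OF h]])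
    also have "(\<sigma> g * Q) * \<tau> h = \<sigma> g * (Q * \<tau> h)" by (rule assoc_mult_mat[OF s[OF g] Q t[OF h]])
    also have "Q * \<tau> h = ?P * (\<sigma> h * Q)"
      unfolding \<tau>_def by (rule assoc_mult_mat[OF Q A sQ[OF h], symmetric])
    also have "\<sigma> g * (?P * (\<sigma> h * Q)) = (\<sigma> g * ?P) * (\<sigma> h * Q)"
      by (rule assoc_mult_mat[OF s[OF g] P sQ[OF h], symmetric])
    also have "\<sigma> g * ?P = ?P * \<sigma> g" using comm[OF g] by simp
    also have "(?P * \<sigma> g) * (\<sigma> h * Q) = ?P * (\<sigma> g * (\<sigma> h * Q))"
      by (rule assoc_mult_mat[OF P s[OF g] sQ[OF h]])
    also have "\<sigma> g * (\<sigma> h * Q) = \<sigma> (g \<otimes> h) * Q"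
      using assoc_mult_mat[OF s[OF g] s[OF h] Q] rep_mult[OF \<sigma> g h] by simp
    also have "?A * (?P * (\<sigma> (g \<otimes> h) * Q)) = (?A * ?P) * (\<sigma> (g \<otimes> h) * Q)"
      using assoc_mult_mat[OF A P sQ] g h by simp
    finally show ?thesis unfolding AP \<tau>_def by simp
  qed
  moreover have "\<tau> \<one> = 1\<^sub>m k" unfolding \<tau>_def rep_one[OF \<sigma>] using Q QQ by simp
  moreover have "mat_adjoint (\<tau> g) = \<tau> (inv g)" if g: "g \<in> carrier G" for g
    unfolding \<tau>_def adjoint_mult[OF A sQ[OF g]] adjoint_mult[OF s[OF g] Q] adjoint_adjoint[OF Q] rep_inv[OF \<sigma> g]
    using assoc_mult_mat[OF A adjoint_carrier[OF s[OF g]] Q] .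
  ultimately show "unitary_rep G \<tau>" "rep_dim G \<tau> = k" using unitary_repI[of \<tau> k] t by auto
  fix g assume g: "g \<in> carrier G"
  have "Q * \<tau> g = ?P * (\<sigma> g * Q)"
    unfolding \<tau>_def by (rule assoc_mult_mat[OF Q A sQ[OF g], symmetric])
  also have "\<dots> = (\<sigma> g * ?P) * Q"
    using assoc_mult_mat[OF P s[OF g] Q] comm[OF g] by simp
  finally have "Q * \<tau> g * ?A = (\<sigma> g * ?P) * Q * ?A" by simp
  also have "\<dots> = (\<sigma> g * ?P) * ?P" by (rule assoc_mult_mat[OF mult_carrier_mat[OF s[OF g] P] Q A])
  also have "\<dots> = \<sigma> g * ?P" using assoc_mult_mat[OF s[OF g] P P] PP by simp
  finally show "Q * \<tau> g * ?A = \<sigma> g * ?P" .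
qed

text \<open>The matrix form of the fact that the orthogonal complement of an invariant subspace is
  invariant: the adjoint of the hypothesis at \<open>inv g\<close> gives
  \<open>P * \<sigma> g * P = P * \<sigma> g\<close>.\<close>

lemma invariant_projection_commutes:
  assumes \<sigma>: "unitary_rep G \<sigma>" and P: "P \<in> carrier_mat (rep_dim G \<sigma>) (rep_dim G \<sigma>)"
    and adj: "mat_adjoint P = P"
    and inv: "\<And>g. g \<in> carrier G \<Longrightarrow> P * (\<sigma> g * P) = \<sigma> g * P"
    and g: "g \<in> carrier G"
  shows "P * \<sigma> g = \<sigma> g * P"
proof -
  note s = rep_carrier[OF \<sigma> g] and s' = rep_carrier[OF \<sigma> inv_closed[OF g]]
  have "mat_adjoint (P * (\<sigma> (inv g) * P)) = mat_adjoint (\<sigma> (inv g) * P)"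
    using inv[OF inv_closed[OF g]] by simp
  hence "(P * \<sigma> g) * P = P * \<sigma> g"
    using adjoint_mult[OF P mult_carrier_mat[OF s' P]] adjoint_mult[OF s' P] adj
      rep_inv[OF \<sigma> inv_closed[OF g]] g by simp
  thus ?thesis using assoc_mult_mat[OF P s P] inv[OF g] by simp
qed

text \<open>Maschke's theorem for a single invariant subspace: \<open>P\<close> projects onto it and
  \<open>1\<^sub>m (rep_dim G \<sigma>) - P\<close> onto its orthogonal complement. The strict
  bounds on \<open>k1\<close> and \<open>k2\<close> drive the induction on the dimension.\<close>

lemma reducible_split:
  assumes \<sigma>: "unitary_rep G \<sigma>" and pos: "rep_dim G \<sigma> > 0" and red: "\<not> irreducible_rep G \<sigma>"
  obtains P Q1 Q2 k1 k2 where
    "Q1 \<in> carrier_mat (rep_dim G \<sigma>) k1" "mat_adjoint Q1 * Q1 = 1\<^sub>m k1" "Q1 * mat_adjoint Q1 = P"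
    "Q2 \<in> carrier_mat (rep_dim G \<sigma>) k2" "mat_adjoint Q2 * Q2 = 1\<^sub>m k2"
    "Q2 * mat_adjoint Q2 = 1\<^sub>m (rep_dim G \<sigma>) - P"
    "\<And>g. g \<in> carrier G \<Longrightarrow> P * \<sigma> g = \<sigma> g * P"
    "k1 < rep_dim G \<sigma>" "k2 < rep_dim G \<sigma>"
proof -
  let ?m = "rep_dim G \<sigma>"
  from red pos obtain W where W: "VectorSpace.subspace class_ring W (module_vec TYPE(complex) ?m)"
    and W_inv: "\<And>g w. g \<in> carrier G \<Longrightarrow> w \<in> W \<Longrightarrow> \<sigma> g *\<^sub>v w \<in> W"
    and W_ne: "W \<noteq> {0\<^sub>v ?m}" "W \<noteq> carrier_vec ?m"
    unfolding irreducible_rep_def by blast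
  note W' = W[unfolded subspace_vec_iff]
  obtain k1 Q1 where Q1: "Q1 \<in> carrier_mat ?m k1" "mat_adjoint Q1 * Q1 = 1\<^sub>m k1"
    and fix_W: "\<And>w. w \<in> W \<Longrightarrow> (Q1 * mat_adjoint Q1) *\<^sub>v w = w"
    and into_W: "\<And>v. v \<in> carrier_vec ?m \<Longrightarrow> (Q1 * mat_adjoint Q1) *\<^sub>v v \<in> W"
    using subspace_orthonormal_basis[OF W] by metis
  define P where "P = Q1 * mat_adjoint Q1"
  have P: "P \<in> carrier_mat ?m ?m" unfolding P_def using Q1(1) by auto
  have adj: "mat_adjoint P = P"
    unfolding P_def using adjoint_mult[OF Q1(1) adjoint_carrier[OF Q1(1)]] Q1(1) by simp
  have idem: "P * P = P"
  proof (rule mat_eqI_mult_vec)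
    fix v :: "complex vec" assume v: "v \<in> carrier_vec ?m"
    show "(P * P) *\<^sub>v v = P *\<^sub>v v"
      using assoc_mult_mat_vec[OF P P v] fix_W into_W[OF v] unfolding P_def by simp
  qed (use P in auto)
  have inv: "P * (\<sigma> g * P) = \<sigma> g * P" if g: "g \<in> carrier G" for g
  proof (rule mat_eqI_mult_vec)
    note s = rep_carrier[OF \<sigma> g]
    fix v :: "complex vec" assume v: "v \<in> carrier_vec ?m"
    have "\<sigma> g *\<^sub>v (P *\<^sub>v v) \<in> W" using W_inv[OF g] into_W[OF v] unfolding P_def by simp
    hence "P *\<^sub>v (\<sigma> g *\<^sub>v (P *\<^sub>v v)) = \<sigma> g *\<^sub>v (P *\<^sub>v v)" using fix_W unfolding P_def by simp
    thus "(P * (\<sigma> g * P)) *\<^sub>v v = (\<sigma> g * P) *\<^sub>v v"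
      using assoc_mult_mat_vec[OF P mult_carrier_mat[OF s P] v] assoc_mult_mat_vec[OF s P v] by simp
  qed (use P rep_carrier[OF \<sigma> g] in auto)
  let ?R = "1\<^sub>m ?m - P"
  have R: "?R \<in> carrier_mat ?m ?m" using P by (intro minus_carrier_mat)
  have Radj: "mat_adjoint ?R = ?R"
  proof (rule eq_matI)
    fix i j assume "i < dim_row ?R" "j < dim_col ?R"
    hence ij: "i < ?m" "j < ?m" using P by auto
    have "cnj (P $$ (j, i)) = P $$ (i, j)" using adjoint_index[OF P ij] adj by simp
    thus "mat_adjoint ?R $$ (i, j) = ?R $$ (i, j)"
      unfolding adjoint_index[OF R ij] using ij P by auto
  qed (use P in auto)
  have "?R * ?R = ?R - P * ?R" using minus_mult_distrib_mat[OF one_carrier_mat P R] left_mult_one_mat[OF R] by simp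
  also have "P * ?R = P - P * P" using mult_minus_distrib_mat[OF P one_carrier_mat P] P by simp
  also have "\<dots> = 0\<^sub>m ?m ?m" unfolding idem using P by simp
  also have "?R - 0\<^sub>m ?m ?m = ?R" by (intro eq_matI) (use P in auto)
  finally have Ridem: "?R * ?R = ?R" .
  obtain k2 Q2 where Q2: "Q2 \<in> carrier_mat ?m k2" "mat_adjoint Q2 * Q2 = 1\<^sub>m k2" "Q2 * mat_adjoint Q2 = ?R"
    using projection_factorization[OF R Radj Ridem] .
  \<comment> \<open>The ranks are the traces of the two complementary projections, by cyclicity of
    the trace.\<close>
  have "complex_of_nat k1 + of_nat k2 = (\<Sum>i<?m. P $$ (i, i)) + (\<Sum>i<?m. ?R $$ (i, i))"
    using sum_diag_mult_adjoint(1)[OF Q1(1)] sum_diag_mult_adjoint(1)[OF Q2(1)] Q1(2) Q2(2,3)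
    unfolding P_def by simp
  also have "\<dots> = of_nat ?m" using P by (simp add: sum.distrib[symmetric])
  finally have sum: "k1 + k2 = ?m" by (metis of_nat_add of_nat_eq_iff)
  \<comment> \<open>A vanishing \<open>k1\<close> would make the subspace zero and a vanishing
    \<open>k2\<close> would make it everything; as they add up to the dimension, both are then
    strictly smaller than it.\<close>
  have "k1 \<noteq> 0"
  proof
    assume "k1 = 0"
    hence P0: "P = 0\<^sub>m ?m ?m" unfolding P_def using Q1(1) by (intro eq_matI) (auto simp: scalar_prod_def)
    have "w = 0\<^sub>v ?m" if "w \<in> W" for w
    proof -
      have "w \<in> carrier_vec ?m" using that W' by auto
      hence "P *\<^sub>v w = 0\<^sub>v ?m" unfolding P0 by (intro eq_vecI) auto
      thus ?thesis using fix_W[OF that] unfolding P_def by simp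
    qed
    thus False using W_ne(1) W' by auto
  qed
  moreover have "k2 \<noteq> 0"
  proof
    assume "k2 = 0"
    hence R0: "?R = 0\<^sub>m ?m ?m" unfolding Q2(3)[symmetric] using Q2(1) by (intro eq_matI) (auto simp: scalar_prod_def)
    have "P = 1\<^sub>m ?m"
    proof (rule eq_matI)
      fix i j assume ij: "i < dim_row (1\<^sub>m ?m :: complex mat)" "j < dim_col (1\<^sub>m ?m :: complex mat)"
      hence "?R $$ (i, j) = 0" unfolding R0 by simp
      thus "P $$ (i, j) = 1\<^sub>m ?m $$ (i, j)" using ij P by auto
    qed (use P in auto)
    hence "v \<in> W" if "v \<in> carrier_vec ?m" for v using into_W[OF that] that unfolding P_def[symmetric] by simp
    thus False using W_ne(2) W' by auto
  qed
  ultimately have "k1 < ?m" "k2 < ?m" using sum by auto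
  with that[OF Q1 P_def[symmetric] Q2] invariant_projection_commutes[OF \<sigma> P adj inv] show ?thesis by blast
qed

text \<open>Strong induction on the dimension: an irreducible representation is equivalent to a
  member of \<open>R\<close>, and a reducible one splits into two smaller ones. Dimension zero is a
  separate case because \<open>irreducible_rep\<close> excludes it.\<close>

lemma rep_lin_zero_unitary:
  assumes dual: "unitary_dual G R"
    and zero: "\<And>\<rho>. \<rho> \<in> R \<Longrightarrow> rep_lin G \<rho> f = 0\<^sub>m (rep_dim G \<rho>) (rep_dim G \<rho>)"
    and \<sigma>: "unitary_rep G \<sigma>"
  shows "rep_lin G \<sigma> f = 0\<^sub>m (rep_dim G \<sigma>) (rep_dim G \<sigma>)"
  using \<sigma>
proof (induction "rep_dim G \<sigma>" arbitrary: \<sigma> rule: less_induct)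
  case less
  let ?m = "rep_dim G \<sigma>"
  note \<sigma> = less.prems
  consider "?m = 0" | "irreducible_rep G \<sigma>" | "?m > 0" "\<not> irreducible_rep G \<sigma>" by auto
  thus ?case
  proof cases
    case 1
    thus ?thesis by (intro eq_matI) (auto simp: rep_lin_def)
  next
    case 2
    with dual \<sigma> obtain \<rho> where "\<rho> \<in> R" "equivalent_reps G \<sigma> \<rho>" "unitary_rep G \<rho>"
      unfolding unitary_dual_def by blast
    thus ?thesis using rep_lin_zero_equivalent[OF \<sigma>] zero by blast
  next
    case 3
    obtain P Q1 Q2 k1 k2 where Q1: "Q1 \<in> carrier_mat ?m k1" "mat_adjoint Q1 * Q1 = 1\<^sub>m k1" "Q1 * mat_adjoint Q1 = P"
      and Q2: "Q2 \<in> carrier_mat ?m k2" "mat_adjoint Q2 * Q2 = 1\<^sub>m k2" "Q2 * mat_adjoint Q2 = 1\<^sub>m ?m - P"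
      and comm: "\<And>g. g \<in> carrier G \<Longrightarrow> P * \<sigma> g = \<sigma> g * P"
      and k: "k1 < ?m" "k2 < ?m"
      using reducible_split[OF \<sigma> 3] by metis
    have P: "P \<in> carrier_mat ?m ?m" using Q1 by auto
    have comm': "(1\<^sub>m ?m - P) * \<sigma> g = \<sigma> g * (1\<^sub>m ?m - P)" if g: "g \<in> carrier G" for g
      using minus_mult_distrib_mat[OF one_carrier_mat P rep_carrier[OF \<sigma> g]]
        mult_minus_distrib_mat[OF rep_carrier[OF \<sigma> g] one_carrier_mat P] comm[OF g] rep_carrier[OF \<sigma> g] by simp
    have vanish: "(\<Sum>g\<in>carrier G. f g * (\<sigma> g * (Q * mat_adjoint Q)) $$ (i, j)) = 0"
      if Q: "Q \<in> carrier_mat ?m k" "mat_adjoint Q * Q = 1\<^sub>m k" and k: "k < ?m"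
        and comm: "\<And>g. g \<in> carrier G \<Longrightarrow> (Q * mat_adjoint Q) * \<sigma> g = \<sigma> g * (Q * mat_adjoint Q)"
        and ij: "i < ?m" "j < ?m" for Q k i j
    proof -
      note \<tau> = compressed_rep[OF \<sigma> Q comm]
      \<comment> \<open>The induction hypothesis applies to the compression, of dimension
        \<open>k\<close>, and sandwiching with \<open>Q\<close> returns to the ambient
        space.\<close>
      have "(\<Sum>g\<in>carrier G. f g * (Q * (mat_adjoint Q * (\<sigma> g * Q)) * mat_adjoint Q) $$ (i, j)) = 0"
        using Q(1) \<tau>(2) k by (intro rep_lin_zero_sandwich[OF \<tau>(1) _ _ ij] less.hyps \<tau>(1)) auto
      thus ?thesis using \<tau>(3) by simp
    qed
    show ?thesis
    proof (rule eq_matI)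
      fix i j assume "i < dim_row (0\<^sub>m ?m ?m :: complex mat)" "j < dim_col (0\<^sub>m ?m ?m :: complex mat)"
      hence ij: "i < ?m" "j < ?m" by auto
      have split: "\<sigma> g $$ (i, j) = (\<sigma> g * P) $$ (i, j) + (\<sigma> g * (1\<^sub>m ?m - P)) $$ (i, j)" if g: "g \<in> carrier G" for g
      proof -
        note s = rep_carrier[OF \<sigma> g]
        have "\<sigma> g * (1\<^sub>m ?m - P) = \<sigma> g - \<sigma> g * P" using mult_minus_distrib_mat[OF s one_carrier_mat P] s by simp
        thus ?thesis using ij s P by simp
      qed
      have "rep_lin G \<sigma> f $$ (i, j) = (\<Sum>g\<in>carrier G. f g * \<sigma> g $$ (i, j))"
        using ij unfolding rep_lin_def by simp
      also have "\<dots> = (\<Sum>g\<in>carrier G. f g * (\<sigma> g * P) $$ (i, j)) + (\<Sum>g\<in>carrier G. f g * (\<sigma> g * (1\<^sub>m ?m - P)) $$ (i, j))"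
        unfolding sum.distrib[symmetric] by (intro sum.cong refl) (simp only: split distrib_left)
      also have "\<dots> = 0"
        using vanish[OF Q1(1,2) k(1) _ ij] vanish[OF Q2(1,2) k(2) _ ij] comm comm' Q1(3) Q2(3) by simp
      finally show "rep_lin G \<sigma> f $$ (i, j) = 0\<^sub>m ?m ?m $$ (i, j)" using ij by simp
    qed (auto simp: rep_lin_def)
  qed
qed

text \<open>The left regular representation is unitary, so \<open>rep_lin_zero_unitary\<close>
  applies to it, and its column at the identity lists the values of \<open>f\<close>.\<close>

lemma dual_separates_functions:
  assumes dual: "unitary_dual G R"
    and zero: "\<And>\<rho>. \<rho> \<in> R \<Longrightarrow> rep_lin G \<rho> f = 0\<^sub>m (rep_dim G \<rho>) (rep_dim G \<rho>)"
    and h: "h \<in> carrier G"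
  shows "f h = 0"
proof -
  let ?n = "card (carrier G)"
  \<comment> \<open>An enumeration of the group, since matrix indices are natural numbers.\<close>
  obtain e where "bij_betw e {0..<?n} (carrier G)" using ex_bij_betw_nat_finite[OF finite_carrier] by auto
  hence e: "bij_betw e {..<?n} (carrier G)" by (simp add: lessThan_atLeast0)
  hence e_in: "e a \<in> carrier G" if "a < ?n" for a using that by (auto simp: bij_betw_def)
  have e_inj: "e a = e b \<longleftrightarrow> a = b" if "a < ?n" "b < ?n" for a b
    using that e by (auto simp: bij_betw_def inj_on_def)
  define \<sigma> where "\<sigma> g = mat ?n ?n (\<lambda>(a, b). of_bool (e a = g \<otimes> e b) :: complex)" for g
  have carr: "\<sigma> g \<in> carrier_mat ?n ?n" for g unfolding \<sigma>_def by simp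
  have ind: "\<sigma> g $$ (a, b) = of_bool (e a = g \<otimes> e b)" if "a < ?n" "b < ?n" for g a b
    unfolding \<sigma>_def using that by simp
  have mult: "\<sigma> (g \<otimes> h) = \<sigma> g * \<sigma> h" if gh: "g \<in> carrier G" "h \<in> carrier G" for g h
  proof (rule eq_matI)
    fix a b assume "a < dim_row (\<sigma> g * \<sigma> h)" "b < dim_col (\<sigma> g * \<sigma> h)"
    hence ab: "a < ?n" "b < ?n" using carr[of g] carr[of h] by auto
    have "(\<sigma> g * \<sigma> h) $$ (a, b) = (\<Sum>c<?n. of_bool (e a = g \<otimes> e c) * of_bool (e c = h \<otimes> e b))"
      using ab by (simp add: mult_index[OF carr carr] ind del: index_mult_mat)
    also have "\<dots> = (\<Sum>y\<in>carrier G. of_bool (e a = g \<otimes> y) * of_bool (y = h \<otimes> e b))"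
      by (rule sum.reindex_bij_betw[OF e])
    also have "\<dots> = (\<Sum>y\<in>carrier G. if y = h \<otimes> e b then of_bool (e a = g \<otimes> y) else 0)"
      by (intro sum.cong refl) auto
    also have "\<dots> = of_bool (e a = g \<otimes> (h \<otimes> e b))" using gh e_in[OF ab(2)] by simp
    also have "\<dots> = \<sigma> (g \<otimes> h) $$ (a, b)" using gh e_in ab by (simp add: ind m_assoc)
    finally show "\<sigma> (g \<otimes> h) $$ (a, b) = (\<sigma> g * \<sigma> h) $$ (a, b)" by simp
  qed (auto simp: \<sigma>_def)
  have one: "\<sigma> \<one> = 1\<^sub>m ?n"
    by (rule eq_matI) (auto simp: \<sigma>_def e_in e_inj)
  have adj: "mat_adjoint (\<sigma> g) = \<sigma> (inv g)" if g: "g \<in> carrier G" for g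
  proof (rule eq_matI)
    fix a b assume "a < dim_row (\<sigma> (inv g))" "b < dim_col (\<sigma> (inv g))"
    hence ab: "a < ?n" "b < ?n" using carr[of "inv g"] by auto
    have "e b = g \<otimes> e a \<longleftrightarrow> e a = inv g \<otimes> e b"
      using g e_in[OF ab(1)] e_in[OF ab(2)] by (metis inv_closed inv_solve_left)
    thus "mat_adjoint (\<sigma> g) $$ (a, b) = \<sigma> (inv g) $$ (a, b)"
      using ab by (simp add: adjoint_index[OF carr] ind)
  qed (auto simp: \<sigma>_def)
  have \<sigma>: "unitary_rep G \<sigma>" "rep_dim G \<sigma> = ?n"
    using unitary_repI[of \<sigma> ?n] carr mult one adj by blast+
  \<comment> \<open>In the row of \<open>h\<close> and the column of the identity, the permutation
    matrix of \<open>g\<close> has a 1 exactly when \<open>g = h\<close>.\<close>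
  obtain a b where ab: "a < ?n" "b < ?n" "e a = h" "e b = \<one>"
    using e h one_closed unfolding bij_betw_def by (metis imageE lessThan_iff)
  have "rep_lin G \<sigma> f $$ (a, b) = 0"
    using rep_lin_zero_unitary[OF dual zero \<sigma>(1)] ab \<sigma>(2) by simp
  moreover have "rep_lin G \<sigma> f $$ (a, b) = (\<Sum>g\<in>carrier G. if g = h then f g else 0)"
    unfolding rep_lin_def \<sigma>(2) using ab by (auto simp: ind intro!: sum.cong)
  ultimately show ?thesis using h by simp
qed

end

section \<open>Contraction of the group tensor\<close>

lemma mode_action_0: "mode_action 0 J U T rs = T []"
proof -
  have "index_tuples 0 J = {[]}" unfolding index_tuples_def by auto
  thus ?thesis unfolding mode_action_def by simp
qed

lemma mode_action_Suc:
  "mode_action (Suc d) J U T (r # rs) = (\<Sum>g\<in>J. U r g * mode_action d J U (\<lambda>gs. T (g # gs)) rs)"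
proof -
  have tuples: "index_tuples (Suc d) J = (\<lambda>(g, gs). g # gs) ` (J \<times> index_tuples d J)"
    unfolding index_tuples_def by (auto simp: length_Suc_conv image_iff)
  have "mode_action (Suc d) J U T (r # rs) =
      (\<Sum>(g, gs)\<in>J \<times> index_tuples d J. U r g * ((\<Prod>k<d. U (rs ! k) (gs ! k)) * T (g # gs)))"
    unfolding mode_action_def tuples
    by (subst sum.reindex) (auto simp: inj_on_def prod.lessThan_Suc_shift mult.assoc intro!: sum.cong simp del: prod.lessThan_Suc)
  thus ?thesis unfolding mode_action_def sum_distrib_left sum.cartesian_product .
qed

text \<open>Compared with the tensor on \<open>ps\<close> alone, there is one more delta and the row
  index of \<open>X\<close> is taken from \<open>p\<close>; this matches what one convolution does
  to the matrix entry.\<close>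

lemma matmul_tensor_Suc:
  "matmul_tensor (Suc (Suc k)) X (p # ps) =
     of_bool (snd p = fst (ps ! 0)) * (\<Prod>l<k. of_bool (snd (ps ! l) = fst (ps ! Suc l))) *
     X $$ (fst p, snd (ps ! k))"
  unfolding matmul_tensor_def by (simp add: prod.lessThan_Suc_shift del: prod.lessThan_Suc)

section \<open>The Fourier matrix, its unitarity and its action on the group tensor\<close>

context finite_group
begin

definition fourier_scale :: "('a \<Rightarrow> complex mat) \<Rightarrow> complex" where
  "fourier_scale \<rho> = complex_of_real (sqrt (real (rep_dim G \<rho>) / real (Coset.order G)))"

fun fourier :: "('a \<Rightarrow> complex mat) \<times> nat \<times> nat \<Rightarrow> 'a \<Rightarrow> complex" where
  "fourier (\<rho>, i, j) g = fourier_scale \<rho> * \<rho> g $$ (i, j)"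

context
  fixes R :: "('a \<Rightarrow> complex mat) set"
  assumes dual: "unitary_dual G R"
begin

lemma dual_rep:
  assumes "\<rho> \<in> R"
  shows "unitary_rep G \<rho>" "irreducible_rep G \<rho>" "rep_dim G \<rho> > 0"
  using dual assms unfolding unitary_dual_def irreducible_rep_def by auto

lemma order_pos: "Coset.order G > 0"
  using order_gt_0_iff_finite finite_carrier by simp

lemma fourier_scale_square:
  "fourier_scale \<rho> * fourier_scale \<rho> = of_nat (rep_dim G \<rho>) / of_nat (Coset.order G)"
  unfolding fourier_scale_def of_real_mult[symmetric] by simp

lemma fourier_scale_nonzero:
  assumes "\<rho> \<in> R" shows "fourier_scale \<rho> \<noteq> 0"
  using dual_rep(3)[OF assms] order_pos unfolding fourier_scale_def by simp

lemma schur_orthogonality: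
  assumes \<rho>: "\<rho> \<in> R" and \<sigma>: "\<sigma> \<in> R"
    and ij: "i < rep_dim G \<rho>" "j < rep_dim G \<rho>" and kl: "k < rep_dim G \<sigma>" "l < rep_dim G \<sigma>"
  shows "(\<Sum>g\<in>carrier G. \<rho> g $$ (i, j) * cnj (\<sigma> g $$ (k, l)))
    = of_nat (Coset.order G) / of_nat (rep_dim G \<rho>) * of_bool (\<rho> = \<sigma> \<and> i = k \<and> j = l)"
proof (cases "\<rho> = \<sigma>")
  case True
  thus ?thesis using schur_orthogonality_self[OF dual_rep(1,2)[OF \<rho>]] ij kl by simp
next
  case False
  hence "\<not> equivalent_reps G \<sigma> \<rho>" using dual \<rho> \<sigma> unfolding unitary_dual_def by metis
  thus ?thesis
    using schur_orthogonality_inequivalent[OF dual_rep(1,2)[OF \<rho>] dual_rep(1,2)[OF \<sigma>]] ij kl False by simp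
qed

lemma fourier_orthonormal: "orthonormal_on (block_index G R) (carrier G) fourier"
  unfolding orthonormal_on_def
proof (intro ballI)
  fix r s assume "r \<in> block_index G R" "s \<in> block_index G R"
  then obtain \<rho> i j \<sigma> k l where r: "r = (\<rho>, i, j)" and s: "s = (\<sigma>, k, l)" and \<rho>: "\<rho> \<in> R" and \<sigma>: "\<sigma> \<in> R"
    and ij: "i < rep_dim G \<rho>" "j < rep_dim G \<rho>" and kl: "k < rep_dim G \<sigma>" "l < rep_dim G \<sigma>"
    unfolding block_index_def by auto
  have "(\<Sum>g\<in>carrier G. fourier r g * cnj (fourier s g)) =
      fourier_scale \<rho> * cnj (fourier_scale \<sigma>) * (\<Sum>g\<in>carrier G. \<rho> g $$ (i, j) * cnj (\<sigma> g $$ (k, l)))"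
    unfolding r s by (simp add: sum_distrib_left mult_ac)
  also have "cnj (fourier_scale \<sigma>) = fourier_scale \<sigma>" unfolding fourier_scale_def by simp
  finally show "(\<Sum>g\<in>carrier G. fourier r g * cnj (fourier s g)) = of_bool (r = s)"
    unfolding schur_orthogonality[OF \<rho> \<sigma> ij kl] r s
    using dual_rep(3)[OF \<rho>] order_pos by (auto simp: fourier_scale_square)
qed

text \<open>The residue \<open>f\<close> of the point mass at \<open>g\<close> is orthogonal to all
  coefficients, hence zero by \<open>dual_separates_functions\<close>; the claim is its value at
  \<open>h\<close>.\<close>

lemma fourier_complete:
  assumes g: "g \<in> carrier G" and h: "h \<in> carrier G"
  shows "(\<Sum>r\<in>block_index G R. cnj (fourier r g) * fourier r h) = of_bool (g = h)"
proof -
  let ?I = "block_index G R"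
  have fin: "finite ?I" using orthonormal_on_finite[OF fourier_orthonormal] by simp
  define f where "f x = of_bool (x = g) - (\<Sum>r\<in>?I. cnj (fourier r g) * fourier r x)" for x
  have "(\<Sum>x\<in>carrier G. of_bool (x = g) * cnj (fourier r x)) = (\<Sum>x\<in>carrier G. if x = g then cnj (fourier r x) else 0)" for r
    by (intro sum.cong) auto
  hence coeff: "(\<Sum>x\<in>carrier G. of_bool (x = g) * cnj (fourier r x)) = cnj (fourier r g)" for r
    using g by simp
  have ortho: "(\<Sum>x\<in>carrier G. f x * cnj (fourier s x)) = 0" if "s \<in> ?I" for s
    using orthonormal_on_residue[OF fourier_orthonormal fin that, of "\<lambda>x. of_bool (x = g)"]
    unfolding coeff f_def .
  \<comment> \<open>Orthogonality pairs \<open>f\<close> with conjugated coefficients, whereas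
    \<open>rep_lin\<close> uses the coefficients themselves; hence \<open>f\<close> is
    conjugated.\<close>
  have "rep_lin G \<rho> (\<lambda>x. cnj (f x)) = 0\<^sub>m (rep_dim G \<rho>) (rep_dim G \<rho>)" if \<rho>: "\<rho> \<in> R" for \<rho>
  proof (rule eq_matI)
    fix i j assume "i < dim_row (0\<^sub>m (rep_dim G \<rho>) (rep_dim G \<rho>) :: complex mat)"
      "j < dim_col (0\<^sub>m (rep_dim G \<rho>) (rep_dim G \<rho>) :: complex mat)"
    hence ij: "i < rep_dim G \<rho>" "j < rep_dim G \<rho>" by auto
    hence "(\<rho>, i, j) \<in> ?I" using \<rho> unfolding block_index_def by auto
    from ortho[OF this] have "cnj (\<Sum>x\<in>carrier G. f x * cnj (fourier (\<rho>, i, j) x)) = 0" by simp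
    hence "fourier_scale \<rho> * (\<Sum>x\<in>carrier G. cnj (f x) * \<rho> x $$ (i, j)) = 0"
      by (simp add: sum_distrib_left mult_ac)
    hence "(\<Sum>x\<in>carrier G. cnj (f x) * \<rho> x $$ (i, j)) = 0" using fourier_scale_nonzero[OF \<rho>] by simp
    thus "rep_lin G \<rho> (\<lambda>x. cnj (f x)) $$ (i, j) = 0\<^sub>m (rep_dim G \<rho>) (rep_dim G \<rho>) $$ (i, j)"
      using ij unfolding rep_lin_def by simp
  qed (auto simp: rep_lin_def)
  from dual_separates_functions[OF dual this h] have "f h = 0" by simp
  thus ?thesis unfolding f_def by auto
qed

lemma fourier_unitary: "unitary_on (Coset.order G) (block_index G R) (carrier G) fourier"
proof -
  let ?I = "block_index G R"
  have fin: "finite ?I" using orthonormal_on_finite[OF fourier_orthonormal] by simp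
  \<comment> \<open>Counting the squared moduli by rows and by columns gives the dimension formula:
    the squares of the dimensions add up to the group order.\<close>
  have "of_nat (card ?I) = (\<Sum>r\<in>?I. \<Sum>g\<in>carrier G. fourier r g * cnj (fourier r g))"
    using fourier_orthonormal by (simp add: orthonormal_on_def)
  also have "\<dots> = (\<Sum>g\<in>carrier G. \<Sum>r\<in>?I. cnj (fourier r g) * fourier r g)"
    by (subst sum.swap) (simp add: mult.commute)
  also have "\<dots> = of_nat (Coset.order G)" by (simp add: fourier_complete Coset.order_def)
  finally have "card ?I = Coset.order G" by (simp only: of_nat_eq_iff)
  thus ?thesis using fin fourier_orthonormal fourier_complete
    by (simp add: unitary_on_def orthonormal_on_def Coset.order_def)
qed

text \<open>Expanding the coefficient of \<open>\<sigma>\<close> at \<open>inv g \<otimes> h\<close>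
  exposes a conjugated coefficient at \<open>g\<close>, to which Schur orthogonality applies. For
  \<open>\<sigma> \<noteq> \<rho>\<close> the index \<open>l\<close> may be out of range on the
  right, but there the factor in front is zero.\<close>

lemma coefficient_convolution:
  assumes \<rho>: "\<rho> \<in> R" and \<sigma>: "\<sigma> \<in> R" and h: "h \<in> carrier G"
    and ij: "i < rep_dim G \<rho>" "j < rep_dim G \<rho>" and kl: "k < rep_dim G \<sigma>" "l < rep_dim G \<sigma>"
  shows "(\<Sum>g\<in>carrier G. \<rho> g $$ (i, j) * \<sigma> (inv g \<otimes> h) $$ (k, l))
    = of_bool (\<rho> = \<sigma> \<and> j = k) * (of_nat (Coset.order G) / of_nat (rep_dim G \<rho>)) * \<rho> h $$ (i, l)"
proof -
  have "(\<Sum>g\<in>carrier G. \<rho> g $$ (i, j) * \<sigma> (inv g \<otimes> h) $$ (k, l))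
      = (\<Sum>g\<in>carrier G. \<Sum>b<rep_dim G \<sigma>. \<rho> g $$ (i, j) * cnj (\<sigma> g $$ (b, k)) * \<sigma> h $$ (b, l))"
    using h kl by (intro sum.cong refl)
      (simp add: rep_mult_index[OF dual_rep(1)[OF \<sigma>]] rep_inv_index[OF dual_rep(1)[OF \<sigma>]] sum_distrib_left mult.assoc)
  also have "\<dots> = (\<Sum>b<rep_dim G \<sigma>. (\<Sum>g\<in>carrier G. \<rho> g $$ (i, j) * cnj (\<sigma> g $$ (b, k))) * \<sigma> h $$ (b, l))"
    by (subst sum.swap) (simp add: sum_distrib_right)
  also have "\<dots> = (\<Sum>b<rep_dim G \<sigma>. if b = i then
      of_bool (\<rho> = \<sigma> \<and> j = k) * (of_nat (Coset.order G) / of_nat (rep_dim G \<rho>)) * \<sigma> h $$ (b, l) else 0)"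
    using kl by (intro sum.cong refl) (auto simp: schur_orthogonality[OF \<rho> \<sigma> ij])
  also have "\<dots> = of_bool (\<rho> = \<sigma> \<and> j = k) * (of_nat (Coset.order G) / of_nat (rep_dim G \<rho>)) * \<rho> h $$ (i, l)"
    using ij by auto
  finally show ?thesis .
qed

text \<open>The contraction of one further mode: a left translate of \<open>x\<close> becomes a
  translate of the coefficient of \<open>\<sigma>\<close>, and the convolution collapses.\<close>

lemma rep_lin_convolution:
  assumes \<rho>: "\<rho> \<in> R" and \<sigma>: "\<sigma> \<in> R"
    and ij: "i < rep_dim G \<rho>" "j < rep_dim G \<rho>" and kl: "k < rep_dim G \<sigma>" "l < rep_dim G \<sigma>"
  shows "(\<Sum>g\<in>carrier G. fourier (\<rho>, i, j) g * rep_lin G \<sigma> (\<lambda>h. x (g \<otimes> h)) $$ (k, l))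
    = of_bool (\<rho> = \<sigma> \<and> j = k) * (1 / fourier_scale \<rho>) * rep_lin G \<rho> x $$ (i, l)"
proof -
  have shift: "rep_lin G \<sigma> (\<lambda>h. x (g \<otimes> h)) $$ (k, l) = (\<Sum>h\<in>carrier G. x h * \<sigma> (inv g \<otimes> h) $$ (k, l))"
    if g: "g \<in> carrier G" for g
  proof -
    have "rep_lin G \<sigma> (\<lambda>h. x (g \<otimes> h)) $$ (k, l) = (\<Sum>h\<in>carrier G. x (g \<otimes> h) * \<sigma> h $$ (k, l))"
      using kl unfolding rep_lin_def by simp
    also have "\<dots> = (\<Sum>h\<in>carrier G. x (g \<otimes> h) * \<sigma> (inv g \<otimes> (g \<otimes> h)) $$ (k, l))"
      using g by (intro sum.cong refl) (simp add: m_assoc[symmetric])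
    also have "\<dots> = (\<Sum>h\<in>carrier G. x h * \<sigma> (inv g \<otimes> h) $$ (k, l))" by (rule sum_mult_left[OF g])
    finally show ?thesis .
  qed
  have "(\<Sum>g\<in>carrier G. fourier (\<rho>, i, j) g * rep_lin G \<sigma> (\<lambda>h. x (g \<otimes> h)) $$ (k, l))
      = (\<Sum>g\<in>carrier G. \<Sum>h\<in>carrier G. fourier_scale \<rho> * x h * (\<rho> g $$ (i, j) * \<sigma> (inv g \<otimes> h) $$ (k, l)))"
    by (intro sum.cong refl) (simp add: shift sum_distrib_left mult_ac)
  also have "\<dots> = (\<Sum>h\<in>carrier G. fourier_scale \<rho> * x h * (\<Sum>g\<in>carrier G. \<rho> g $$ (i, j) * \<sigma> (inv g \<otimes> h) $$ (k, l)))"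
    by (subst sum.swap) (simp add: sum_distrib_left)
  \<comment> \<open>The conditional keeps the unfolding of \<open>rep_lin\<close> within range, as
    \<open>l\<close> is bounded only by the dimension of \<open>\<sigma>\<close>.\<close>
  also have "\<dots> = of_bool (\<rho> = \<sigma> \<and> j = k) * (fourier_scale \<rho> * (of_nat (Coset.order G) / of_nat (rep_dim G \<rho>))) *
      (if l < rep_dim G \<rho> then rep_lin G \<rho> x $$ (i, l) else 0)"
    using ij kl by (auto simp: coefficient_convolution[OF \<rho> \<sigma> _ ij kl] rep_lin_def sum_distrib_left sum_divide_distrib mult_ac intro!: sum.cong)
  also have "fourier_scale \<rho> * (of_nat (Coset.order G) / of_nat (rep_dim G \<rho>)) = 1 / fourier_scale \<rho>"
    using fourier_scale_square[of \<rho>] fourier_scale_nonzero[OF \<rho>] dual_rep(3)[OF \<rho>] order_pos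
    by (simp add: field_simps)
  finally show ?thesis using kl by auto
qed

text \<open>Induction over the modes with \<open>x\<close> arbitrary, because fixing the first group
  element replaces \<open>x\<close> by a left translate. One mode gives the factor
  \<open>fourier_scale \<rho>\<close>, and each further mode its reciprocal.\<close>

lemma fourier_group_tensor:
  assumes "rs \<in> index_tuples (Suc k) (block_index G R)"
  shows "mode_action (Suc k) (carrier G) fourier (group_tensor G x) rs =
    hyper_direct_sum (\<lambda>\<rho> ps. fourier_scale \<rho> * (1 / fourier_scale \<rho>) ^ k * matmul_tensor (Suc k) (rep_lin G \<rho> x) ps) rs"
  using assms
proof (induction k arbitrary: rs x)
  case 0
  then obtain \<rho> i j where rs: "rs = [(\<rho>, i, j)]" and ij: "i < rep_dim G \<rho>" "j < rep_dim G \<rho>"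
    unfolding index_tuples_def block_index_def by (auto simp: length_Suc_conv)
  show ?case
    unfolding rs mode_action_Suc mode_action_0 hyper_direct_sum_def matmul_tensor_def group_tensor_def
    using ij by (simp add: rep_lin_def sum_distrib_left mult_ac)
next
  case (Suc k)
  from Suc.prems obtain r ss where rs: "rs = r # ss" and rI: "r \<in> block_index G R"
    and ss: "ss \<in> index_tuples (Suc k) (block_index G R)"
    unfolding index_tuples_def by (auto simp: length_Suc_conv)
  hence len: "length ss = Suc k" and sub: "set ss \<subseteq> block_index G R" unfolding index_tuples_def by auto
  obtain \<rho> i j where r: "r = (\<rho>, i, j)" and \<rho>: "\<rho> \<in> R" and ij: "i < rep_dim G \<rho>" "j < rep_dim G \<rho>"
    using rI unfolding block_index_def by auto
  define \<sigma> where "\<sigma> = fst (hd ss)"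
  define ps where "ps = map snd ss"
  define K where "K = (\<Prod>l<k. of_bool (snd (ps ! l) = fst (ps ! Suc l)) :: complex)"
  define c where "c = fourier_scale \<sigma> * (1 / fourier_scale \<sigma>) ^ k"
  have IH: "mode_action (Suc k) (carrier G) fourier (\<lambda>gs. group_tensor G x (g # gs)) ss =
      (if \<forall>s\<in>set ss. fst s = \<sigma> then c * (K * rep_lin G \<sigma> (\<lambda>h. x (g \<otimes> h)) $$ (fst (ps ! 0), snd (ps ! k))) else 0)" for g
  proof -
    have "(\<lambda>gs. group_tensor G x (g # gs)) = group_tensor G (\<lambda>h. x (g \<otimes> h))"
      by (simp add: group_tensor_def fun_eq_iff)
    thus ?thesis
      unfolding \<sigma>_def ps_def K_def c_def
      by (simp only: Suc.IH[OF ss] hyper_direct_sum_def matmul_tensor_def diff_Suc_1)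
  qed
  show ?case
  \<comment> \<open>If the tail already mixes blocks, both sides vanish; otherwise one convolution
    compares its block \<open>\<sigma>\<close> with the block \<open>\<rho>\<close> of the first
    index.\<close>
  proof (cases "\<forall>s\<in>set ss. fst s = \<sigma>")
    case False
    then obtain s where s: "s \<in> set ss" "fst s \<noteq> fst (hd ss)" unfolding \<sigma>_def by blast
    hence "hd ss \<in> set ss" by (cases ss) simp_all
    hence "\<not> (\<forall>s\<in>set rs. fst s = fst (hd rs))"
      using s unfolding rs by (metis list.sel(1) list.set_intros(2))
    hence "hyper_direct_sum T rs = 0" for T :: "_ \<Rightarrow> _ hypermatrix"
      unfolding hyper_direct_sum_def by (rule if_not_P)
    moreover have "mode_action (Suc k) (carrier G) fourier (\<lambda>gs. group_tensor G x (g # gs)) ss = 0" for g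
      unfolding IH using False by (rule if_not_P)
    ultimately show ?thesis unfolding rs mode_action_Suc by simp
  next
    case True
    have block: "\<sigma> \<in> R \<and> fst (ps ! a) < rep_dim G \<sigma> \<and> snd (ps ! a) < rep_dim G \<sigma>" if "a < Suc k" for a
    proof -
      have "ss ! a \<in> set ss" using that len by auto
      hence "fst (ss ! a) = \<sigma>" "ss ! a \<in> block_index G R" using True sub by blast+
      moreover have "ps ! a = snd (ss ! a)" using that len unfolding ps_def by simp
      ultimately show ?thesis unfolding block_index_def by (cases "ss ! a") auto
    qed
    have "\<sigma> \<in> R" "fst (ps ! 0) < rep_dim G \<sigma>" "snd (ps ! k) < rep_dim G \<sigma>"
      using block[of 0] block[of k] by simp_all
    note conv = rep_lin_convolution[OF \<rho> this(1) ij this(2,3), of x]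
    have "mode_action (Suc k) (carrier G) fourier (\<lambda>gs. group_tensor G x (g # gs)) ss =
        c * (K * rep_lin G \<sigma> (\<lambda>h. x (g \<otimes> h)) $$ (fst (ps ! 0), snd (ps ! k)))" for g
      unfolding IH using True by (rule if_P)
    hence "mode_action (Suc (Suc k)) (carrier G) fourier (group_tensor G x) rs
        = c * K * (\<Sum>g\<in>carrier G. fourier (\<rho>, i, j) g * rep_lin G \<sigma> (\<lambda>h. x (g \<otimes> h)) $$ (fst (ps ! 0), snd (ps ! k)))"
      unfolding rs r mode_action_Suc by (simp only: sum_distrib_left mult_ac)
    also have "\<dots> = c * K * (of_bool (\<rho> = \<sigma> \<and> j = fst (ps ! 0)) * (1 / fourier_scale \<rho>) * rep_lin G \<rho> x $$ (i, snd (ps ! k)))"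
      by (simp only: conv)
    also have "\<dots> = (if \<rho> = \<sigma> then fourier_scale \<rho> * (1 / fourier_scale \<rho>) ^ Suc k *
        matmul_tensor (Suc (Suc k)) (rep_lin G \<rho> x) ((i, j) # ps) else 0)"
      unfolding matmul_tensor_Suc K_def c_def by (cases "\<rho> = \<sigma>") (simp_all add: mult_ac)
    also have "\<dots> = hyper_direct_sum (\<lambda>\<rho> ps. fourier_scale \<rho> * (1 / fourier_scale \<rho>) ^ Suc k *
        matmul_tensor (Suc (Suc k)) (rep_lin G \<rho> x) ps) rs"
    proof -
      \<comment> \<open>The tail is nonempty, so the full tuple lies in one block exactly when
        \<open>\<rho> = \<sigma>\<close>.\<close>
      have "hd ss \<in> set ss" using len by (cases ss) simp_all
      with True have "(\<forall>s\<in>set ss. fst s = \<rho>) \<longleftrightarrow> \<rho> = \<sigma>" by metis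
      hence "(\<forall>s\<in>set rs. fst s = fst (hd rs)) \<longleftrightarrow> \<rho> = \<sigma>" unfolding rs r by simp
      thus ?thesis unfolding hyper_direct_sum_def ps_def by (simp only: rs r list.sel list.map fst_conv snd_conv)
    qed
    finally show ?thesis .
  qed
qed

end

end

section \<open>Unitary block diagonalisation of the group tensor\<close>

theorem theorem3p1:
  fixes G :: "('a, 'b) monoid_scheme"
    and Ghat :: "('a \<Rightarrow> complex mat) set"
    and n d :: nat
  assumes "group G"
    and "finite (carrier G)"
    and "Coset.order G = n"
    and "d \<ge> 2"
    and "unitary_dual G Ghat"
  shows "\<exists>(U :: ('a \<Rightarrow> complex mat) \<times> nat \<times> nat \<Rightarrow> 'a \<Rightarrow> complex)
           (\<gamma> :: ('a \<Rightarrow> complex mat) \<Rightarrow> complex).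
           unitary_on n (block_index G Ghat) (carrier G) U \<and>
           (\<forall>\<rho>\<in>Ghat. \<gamma> \<rho> \<noteq> 0) \<and>
           (\<forall>x :: 'a \<Rightarrow> complex. \<forall>rs \<in> index_tuples d (block_index G Ghat).
              mode_action d (carrier G) U (group_tensor G x) rs =
              hyper_direct_sum (\<lambda>\<rho> ps. \<gamma> \<rho> * matmul_tensor d (rep_lin G \<rho> x) ps) rs)"
proof -
  interpret finite_group G
    using assms by (simp add: finite_group_def finite_group_axioms_def)
  note dual = assms(5)
  \<comment> \<open>Here \<open>k\<close> counts the convolutions, one fewer than the modes, and is
    the exponent in the constants.\<close>
  obtain k where d: "d = Suc k" using assms(4) by (cases d) auto
  show ?thesis
  proof (intro exI conjI)
    show "unitary_on n (block_index G Ghat) (carrier G) fourier"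
      using fourier_unitary[OF dual] assms(3) by simp
    show "\<forall>\<rho>\<in>Ghat. fourier_scale \<rho> * (1 / fourier_scale \<rho>) ^ k \<noteq> 0"
      using fourier_scale_nonzero[OF dual] by simp
    show "\<forall>x. \<forall>rs\<in>index_tuples d (block_index G Ghat). mode_action d (carrier G) fourier (group_tensor G x) rs =
        hyper_direct_sum (\<lambda>\<rho> ps. fourier_scale \<rho> * (1 / fourier_scale \<rho>) ^ k * matmul_tensor d (rep_lin G \<rho> x) ps) rs"
      unfolding d using fourier_group_tensor[OF dual] by blast
  qed
qed

end
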